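(* Let $X$ and $Y$ be two Banach spaces, $A\in\mathcal B(X,Y)$ and $(A_n)_{n\in\mathbb N'}\subset\mathcal B(X,Y)$. Suppose that $\lambda_{\mathbb N'}[A_n,\theta]=0$. Then: 1. If $A$ is a lower semi-Fredholm operator, then for large enough $n\in\mathbb N'$ the operators $A+A_n$ are also lower semi-Fredholm. Moreover, there exists $L\in\mathbb N$ such that $\alpha(A+A_n)\le L$ for the same $n$. 2. If $A$ is a Fredholm operator, then for large enough $n\in\mathbb N'$ the operators $A+A_n$ are also Fredholm and $ind(A+A_n)=ind(A)$. Moreover, there exists $S\in\mathbb N$ such that $\beta(A+A_n)\le S$ for the same $n$.
   Context: $\mathbb N'$ denotes an infinite subset of $\mathbb N$; $\theta$ is the null operator. $\mathcal B(X,Y)$: bounded operators defined on all of $X$. For an operator $A$ with closed range $R(A)$, $\alpha(A)=\dim Ker(A)$ and $\beta(A)=\dim Y/R(A)$. In the terminology used here, $A$ (with closed range) is lower semi-Fredholm if $\alpha(A)<\infty$, and Fredholm if both $\alpha(A)$ and $\beta(A)$ are finite; $ind(A)=\alpha(A)-\beta(A)$. $X\times Y$ has norm $\max\{\|x\|,\|y\|\}$; $G_A$ is the graph of $A$. Uniform $\lambda$-adjustment: a sequence $(M_n)_{\mathbb N'}$ of nonzero closed subspaces of a Banach space $Z$ is lower uniformly $\lambda$-adjusted ($\lambda\ge0$) with a sequence $(P_n)_{\mathbb N'}$ of closed subspaces if for every $\eta>0$, every infinite $\mathbb N''\subset\mathbb N'$ and every sequence of unit vectors $x_n\in M_n$ ($n\in\mathbb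 N''$) there exist an infinite $\mathbb N'''\subset\mathbb N''$, $y_n\in P_n$ ($n\in\mathbb N'''$) and $z\in Z$ with $\varlimsup_{n\in\mathbb N'''}\|x_n-y_n-z\|\le\lambda+\eta$; $\lambda_{\mathbb N'}[M_n,P_n]$ is the infimum of such $\lambda$. For operators, $\lambda_{\mathbb N'}[A_n,B_n]=\lambda_{\mathbb N'}[G_{A_n},G_{B_n}]$ in $X\times Y$; a single operator is regarded as a constant sequence. *)

theory Defs
  imports "HOL-Analysis.Analysis"
begin

section \<open>Uniform adjustment of sequences of subspaces\<close>

text \<open>
  The norm of the ambient Banach space is a parameter \<open>nrm\<close>, because the library norm of a
  product type is the Euclidean one, whereas operators are compared below in the maximum norm.
  The two are equivalent (lemmas \<open>max_norm_le_norm\<close> and \<open>norm_le_max_norm\<close>), so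
  \<^const>\<open>closed\<close> has the intended meaning.

  Sequences indexed by an infinite set \<open>N\<close> of naturals are functions on \<^typ>\<open>nat\<close> of which only
  the values on \<open>N\<close> matter. The zero subspace is admitted as a value of \<open>M\<close>; having no unit
  vectors, it satisfies the condition vacuously. This gives a meaning to the adjustment of
  operators on the zero space, whose graphs are zero.
\<close>

definition lower_uniformly_adjusted ::
  "('z::banach \<Rightarrow> real) \<Rightarrow> real \<Rightarrow> nat set \<Rightarrow> (nat \<Rightarrow> 'z set) \<Rightarrow> (nat \<Rightarrow> 'z set) \<Rightarrow> bool" where
  "lower_uniformly_adjusted nrm l N M P \<longleftrightarrow>
     0 \<le> l \<and>
     (\<forall>n\<in>N. subspace (M n) \<and> closed (M n) \<and> subspace (P n) \<and> closed (P n)) \<and>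
     (\<forall>\<eta>>0. \<forall>N2 x. N2 \<subseteq> N \<and> infinite N2 \<and> (\<forall>n\<in>N2. x n \<in> M n \<and> nrm (x n) = 1) \<longrightarrow>
        (\<exists>N3 y z. N3 \<subseteq> N2 \<and> infinite N3 \<and> (\<forall>n\<in>N3. y n \<in> P n) \<and>
           Limsup (inf sequentially (principal N3)) (\<lambda>n. ereal (nrm (x n - y n - z)))
             \<le> ereal (l + \<eta>)))"

definition adjustment ::
  "('z::banach \<Rightarrow> real) \<Rightarrow> nat set \<Rightarrow> (nat \<Rightarrow> 'z set) \<Rightarrow> (nat \<Rightarrow> 'z set) \<Rightarrow> ereal" where
  "adjustment nrm N M P = Inf (ereal ` {l. lower_uniformly_adjusted nrm l N M P})"

definition max_norm :: "'a::real_normed_vector \<times> 'b::real_normed_vector \<Rightarrow> real" where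
  "max_norm p = max (norm (fst p)) (norm (snd p))"

lemma max_norm_le_norm: "max_norm p \<le> norm p"
  by (cases p) (simp add: max_norm_def norm_fst_le norm_snd_le)

lemma norm_le_max_norm: "norm p \<le> 2 * max_norm p"
  using norm_Pair_le[of "fst p" "snd p"] by (auto simp: max_norm_def)

definition operator_graph :: "('a::real_normed_vector \<Rightarrow>\<^sub>L 'b::real_normed_vector) \<Rightarrow> ('a \<times> 'b) set" where
  "operator_graph A = {(x, blinfun_apply A x) | x. True}"

lemma subspace_operator_graph: "subspace (operator_graph A)"
  by (auto simp: subspace_def operator_graph_def zero_prod_def blinfun.add_right blinfun.scaleR_right)

lemma closed_operator_graph: "closed (operator_graph A)"
proof -
  have "operator_graph A = {p. blinfun_apply A (fst p) = snd p}"
    by (auto simp: operator_graph_def)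
  then show ?thesis
    by (auto intro!: closed_Collect_eq continuous_intros)
qed

definition operator_adjustment ::
  "nat set \<Rightarrow> (nat \<Rightarrow> 'a::banach \<Rightarrow>\<^sub>L 'b::banach) \<Rightarrow> (nat \<Rightarrow> 'a \<Rightarrow>\<^sub>L 'b) \<Rightarrow> ereal" where
  "operator_adjustment N A B =
     adjustment max_norm N (\<lambda>n. operator_graph (A n)) (\<lambda>n. operator_graph (B n))"


section \<open>Semi-Fredholm operators\<close>

text \<open>
  The library function \<^const>\<open>dim\<close> is \<open>0\<close> on infinite-dimensional spaces, so dimensions are
  taken in \<^typ>\<open>enat\<close> here; the infimum of the empty set is \<open>\<infinity>\<close>.
\<close>

definition edim :: "'a::real_vector set \<Rightarrow> enat" where
  "edim V = Inf {enat (card B) | B. finite B \<and> independent B \<and> span B = V}"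

lemma edim_span:
  assumes "finite B" "independent B"
  shows "edim (span B) = enat (card B)"
proof -
  have "card C = card B" if "independent C" "span C = span B" for C
    using that assms by (metis dim_span_eq_card_independent)
  then have "{enat (card C) | C. finite C \<and> independent C \<and> span C = span B} = {enat (card B)}"
    using assms by blast
  then show ?thesis
    by (simp add: edim_def)
qed

text \<open>\<open>quotient_basis W B\<close>: the classes \<open>b + W\<close>, for \<open>b\<close> in the finite set \<open>B\<close>, are pairwise
  distinct and form a basis of the quotient of the whole space by the subspace \<open>W\<close>. The first
  conjunct is linear independence of the classes, the second says that they span.\<close>

definition quotient_basis :: "'a::real_vector set \<Rightarrow> 'a set \<Rightarrow> bool" where
  "quotient_basis W B \<longleftrightarrow>
     finite B \<and>
     (\<forall>c. (\<Sum>b\<in>B. c b *\<^sub>R b) \<in> W \<longrightarrow> (\<forall>b\<in>B. c b = 0)) \<and>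
     (\<forall>y. \<exists>c. y - (\<Sum>b\<in>B. c b *\<^sub>R b) \<in> W)"

definition quotient_edim :: "'a::real_vector set \<Rightarrow> enat" where
  "quotient_edim W = Inf {enat (card B) | B. quotient_basis W B}"

definition nullity :: "('a::real_normed_vector \<Rightarrow>\<^sub>L 'b::real_normed_vector) \<Rightarrow> enat" where
  "nullity A = edim {x. blinfun_apply A x = 0}"

definition deficiency :: "('a::real_normed_vector \<Rightarrow>\<^sub>L 'b::real_normed_vector) \<Rightarrow> enat" where
  "deficiency A = quotient_edim (range (blinfun_apply A))"

definition lower_semi_Fredholm :: "('a::real_normed_vector \<Rightarrow>\<^sub>L 'b::real_normed_vector) \<Rightarrow> bool" where
  "lower_semi_Fredholm A \<longleftrightarrow> closed (range (blinfun_apply A)) \<and> nullity A < \<infinity>"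

definition Fredholm :: "('a::real_normed_vector \<Rightarrow>\<^sub>L 'b::real_normed_vector) \<Rightarrow> bool" where
  "Fredholm A \<longleftrightarrow> closed (range (blinfun_apply A)) \<and> nullity A < \<infinity> \<and> deficiency A < \<infinity>"

definition ind :: "('a::real_normed_vector \<Rightarrow>\<^sub>L 'b::real_normed_vector) \<Rightarrow> ereal" where
  "ind A = ereal_of_enat (nullity A) - ereal_of_enat (deficiency A)"

end

theory Submission
  imports Defs "HOL-Library.Ramsey"
begin

text \<open>
  If \<open>\<lambda>[A\<^sub>n, \<theta>] = 0\<close>, then for every \<open>\<epsilon>\<close> the values \<open>A\<^sub>n x\<close> with \<open>n\<close> large and
  \<open>max (norm x) (norm (A\<^sub>n x)) = 1\<close> have a finite \<open>\<epsilon>\<close>-net that does not depend on \<open>n\<close>. Hence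
  \<open>norm (A\<^sub>n x) \<le> \<epsilon> * norm x\<close> on the common kernel of \<open>m\<close> functionals, with \<open>m\<close> independent of \<open>n\<close>
  although the \<open>A\<^sub>n\<close> need not be uniformly bounded. As \<open>A\<close> is bounded below on a closed subspace of
  finite codimension, all \<open>A + t A\<^sub>n\<close> with \<open>0 \<le> t \<le> 1\<close> are bounded below, with one constant, on a
  closed subspace \<open>E\<close> whose codimension \<open>e\<close> is bounded in \<open>n\<close>. This gives the semi-Fredholm part. The
  index of an operator \<open>T\<close> that is bounded below on \<open>E\<close> is \<open>e\<close> minus the codimension of \<open>T E\<close>, and
  the latter is constant along the segment from \<open>A\<close> to \<open>A + A\<^sub>n\<close>.
\<close>

section \<open>Bases modulo a subspace\<close>

text \<open>The net arises by contradiction. Without it one could choose, with increasing indices,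
  graph vectors of norm 1 whose images are pairwise more than \<epsilon> apart, whereas zero
  adjustment puts infinitely many of these images within \<epsilon>/2 of a single point. Normalising
  by the maximum of both norms copes with the missing uniform bound: once the image is small
  relative to that maximum, the maximum can only be \<open>norm x\<close>. With \<epsilon> equal to
  half the lower bound of \<open>A\<close>, the other half survives for all t in [0,1] at once. The
  subspace \<open>E\<close> varies with n; its codimension bound and the constant do not, and this
  is all that uniform \<open>L\<close> and \<open>S\<close> require. Codimension is transported
  along the segment because finite sets that are independent or generating modulo the image stay so
  under small changes of the operator. The admissible change depends on the norm of a projection
  that has no bound in advance, so connectedness of [0,1] replaces a single perturbation step. The
  bound for the deficiency then follows from equality of the indices and the bound for the
  nullity.\<close>

definition mod_indep :: "'a::real_vector set \<Rightarrow> 'a set \<Rightarrow> bool" where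
  "mod_indep W B \<longleftrightarrow> finite B \<and> (\<forall>c. (\<Sum>b\<in>B. c b *\<^sub>R b) \<in> W \<longrightarrow> (\<forall>b\<in>B. c b = 0))"

text \<open>\<open>mod_indep\<close> and \<open>mod_span\<close> are the two halves of
  \<open>quotient_basis\<close>. They are kept apart because a dimension count compares one with the
  other, and because in infinite codimension only the first half is available.\<close>

definition mod_span :: "'a::real_vector set \<Rightarrow> 'a set \<Rightarrow> bool" where
  "mod_span W B \<longleftrightarrow> finite B \<and> (\<forall>y. \<exists>v\<in>span B. y - v \<in> W)"

lemma mod_indepI:
  assumes "finite B" "\<And>c b. (\<Sum>b\<in>B. c b *\<^sub>R b) \<in> W \<Longrightarrow> b \<in> B \<Longrightarrow> c b = 0"
  shows "mod_indep W B"
  using assms by (simp add: mod_indep_def)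

lemma mod_indepD: "mod_indep W B \<Longrightarrow> (\<Sum>b\<in>B. c b *\<^sub>R b) \<in> W \<Longrightarrow> b \<in> B \<Longrightarrow> c b = 0"
  by (simp add: mod_indep_def)

lemma quotient_basis_iff: "quotient_basis W B \<longleftrightarrow> mod_indep W B \<and> mod_span W B"
  unfolding quotient_basis_def mod_indep_def mod_span_def by (auto simp: span_finite)

text \<open>A linear projection g onto \<open>W\<close> exists algebraically, and x - g x has kernel
  \<open>W\<close>. This map stands in for the quotient map, with values in the same type, so that
  ordinary independence and span apply to classes.\<close>

lemma subspace_is_kernel:
  fixes W :: "'a::real_vector set"
  assumes "subspace W"
  shows "\<exists>\<pi> :: 'a \<Rightarrow> 'a. linear \<pi> \<and> (\<forall>x. \<pi> x = 0 \<longleftrightarrow> x \<in> W)"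
proof -
  obtain g :: "'a \<Rightarrow> 'a" where g: "range g \<subseteq> W" "linear g" "\<forall>v\<in>W. g v = v"
    using linear_exists_left_inverse_on[OF linear_ident assms] by (auto simp: inj_on_def)
  show ?thesis
  proof (intro exI conjI allI)
    show "linear (\<lambda>x. x - g x)"
      using g(2) by (intro linear_compose_sub linear_ident)
    show "x - g x = 0 \<longleftrightarrow> x \<in> W" for x
      using g by (metis eq_iff_diff_eq_0 range_subsetD)
  qed
qed

lemma sum_delta_diff:
  fixes f :: "'a \<Rightarrow> 'b::real_vector"
  assumes "finite B" "x \<in> B" "y \<in> B"
  shows "(\<Sum>b\<in>B. ((if b = x then 1 else 0) - (if b = y then 1 else 0)) *\<^sub>R f b) = f x - f y"
proof -
  have "((if b = x then 1 else 0) - (if b = y then 1 else 0)) *\<^sub>R f b =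
      (if b = x then f b else 0) - (if b = y then f b else 0)" for b
    by simp
  then show ?thesis
    using assms by (simp only: sum_subtractf sum.delta if_True)
qed

lemma mod_indep_kernel:
  assumes "linear \<pi>" and ker: "\<And>x. \<pi> x = 0 \<longleftrightarrow> x \<in> W"
  shows "mod_indep W B \<longleftrightarrow> finite B \<and> inj_on \<pi> B \<and> independent (\<pi> ` B)"
proof -
  have W: "(\<Sum>b\<in>B. c b *\<^sub>R b) \<in> W \<longleftrightarrow> (\<Sum>b\<in>B. c b *\<^sub>R \<pi> b) = 0" for c
    unfolding ker[symmetric] using assms(1) by (simp add: linear_sum linear_scale)
  show ?thesis
  proof (intro iffI conjI)
    assume L: "mod_indep W B"
    then show fin: "finite B"
      by (simp add: mod_indep_def)
    show inj: "inj_on \<pi> B"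
    proof (rule inj_onI, rule ccontr)
      fix x y assume xy: "x \<in> B" "y \<in> B" "\<pi> x = \<pi> y" "x \<noteq> y"
      \<comment> \<open>Two representatives of one class would give the nontrivial relation x - y in
        \<open>W\<close>.\<close>
      let ?c = "\<lambda>b. (if b = x then 1 else 0) - (if b = y then 1 else (0::real))"
      have "(\<Sum>b\<in>B. ?c b *\<^sub>R \<pi> b) = 0"
        using sum_delta_diff[OF fin xy(1,2), of \<pi>] xy by simp
      then have "?c x = 0"
        using mod_indepD[OF L _ xy(1), of ?c] W[of ?c] by simp
      then show False
        using xy by simp
    qed
    have "u v = 0" if "(\<Sum>v\<in>\<pi> ` B. u v *\<^sub>R v) = 0" "v \<in> \<pi> ` B" for u v
    proof -
      have "(\<Sum>b\<in>B. (u \<circ> \<pi>) b *\<^sub>R b) \<in> W"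
        unfolding W using that(1) inj by (simp add: sum.reindex)
      from mod_indepD[OF L this] show ?thesis
        using that(2) by auto
    qed
    then show "independent (\<pi> ` B)"
      using fin by (auto simp: dependent_finite)
  next
    assume R: "finite B \<and> inj_on \<pi> B \<and> independent (\<pi> ` B)"
    have "c b = 0" if "(\<Sum>b\<in>B. c b *\<^sub>R \<pi> b) = 0" "b \<in> B" for c b
    proof -
      let ?u = "c \<circ> the_inv_into B \<pi>"
      have "(\<Sum>v\<in>\<pi> ` B. ?u v *\<^sub>R v) = 0"
        unfolding that(1)[symmetric] using R by (simp add: sum.reindex the_inv_into_f_f)
      then have "?u (\<pi> b) = 0"
        using R that(2) by (intro independentD[of "\<pi> ` B" "\<pi> ` B" ?u]) auto
      then show ?thesis
        using R that by (simp add: the_inv_into_f_f)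
    qed
    then show "mod_indep W B"
      using R W by (intro mod_indepI) auto
  qed
qed

lemma mod_span_kernel:
  assumes "linear \<pi>" and ker: "\<And>x. \<pi> x = 0 \<longleftrightarrow> x \<in> W"
  shows "mod_span W B \<longleftrightarrow> finite B \<and> range \<pi> \<subseteq> span (\<pi> ` B)"
proof -
  have "y - v \<in> W \<longleftrightarrow> \<pi> y = \<pi> v" for y v
    unfolding ker[symmetric] using assms(1) by (simp add: linear_diff)
  then show ?thesis
    unfolding mod_span_def linear_span_image[OF assms(1)] by (auto simp: image_subset_iff image_iff)
qed

text \<open>The Steinitz bound, transported through the substitute \<pi> for the quotient map;
  injectivity of \<pi> on \<open>C\<close> preserves the cardinality.\<close>

lemma mod_indep_card_le:
  fixes W :: "'a::real_vector set"
  assumes "subspace W" "mod_indep W C" "mod_span W B"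
  shows "card C \<le> card B"
proof -
  obtain \<pi> :: "'a \<Rightarrow> 'a" where \<pi>: "linear \<pi>" "\<And>x. \<pi> x = 0 \<longleftrightarrow> x \<in> W"
    using subspace_is_kernel[OF assms(1)] by blast
  have C: "inj_on \<pi> C" "independent (\<pi> ` C)"
    using assms(2) mod_indep_kernel[OF \<pi>] by auto
  have B: "finite B" "\<pi> ` C \<subseteq> span (\<pi> ` B)"
    using assms(3) mod_span_kernel[OF \<pi>] by auto
  have "card (\<pi> ` C) \<le> card (\<pi> ` B)"
    using independent_span_bound C B by blast
  also have "\<dots> \<le> card B"
    using B(1) by (rule card_image_le)
  finally show ?thesis
    using C by (simp add: card_image)
qed

lemma quotient_basis_card_eq:
  assumes "subspace W" "quotient_basis W B" "quotient_basis W C"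
  shows "card B = card C"
  using assms mod_indep_card_le by (metis le_antisym quotient_basis_iff)

lemma quotient_edim_eq:
  assumes "subspace W" "quotient_basis W B"
  shows "quotient_edim W = enat (card B)"
proof -
  have "{enat (card B) | B. quotient_basis W B} = {enat (card B)}"
    using assms quotient_basis_card_eq by blast
  then show ?thesis
    by (simp add: quotient_edim_def)
qed

lemma quotient_edim_finite:
  assumes "quotient_edim W < \<infinity>"
  obtains B where "quotient_basis W B"
proof -
  have "{enat (card B) | B. quotient_basis W B} \<noteq> {}"
    using assms unfolding quotient_edim_def by (metis Inf_empty enat_ord_simps(6) top_enat_def)
  then show thesis using that by blast
qed

lemma edim_finite:
  assumes "edim V < \<infinity>"
  obtains B where "finite B" "independent B" "span B = V"
proof -
  have "{enat (card B) | B. finite B \<and> independent B \<and> span B = V} \<noteq> {}"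
    using assms unfolding edim_def by (metis Inf_empty enat_ord_simps(6) top_enat_def)
  then show thesis using that by blast
qed

lemma mod_indep_insert:
  assumes W: "subspace W" and C: "mod_indep W C" and y: "\<And>v. v \<in> span C \<Longrightarrow> y - v \<notin> W"
  shows "y \<notin> C" "mod_indep W (insert y C)"
proof -
  show yC: "y \<notin> C"
    using y[of y] W by (auto simp: span_base subspace_0)
  have fin: "finite C"
    using C by (simp add: mod_indep_def)
  have "\<forall>b\<in>insert y C. c b = 0" if *: "(\<Sum>b\<in>insert y C. c b *\<^sub>R b) \<in> W" for c
  proof -
    define s where "s = (\<Sum>b\<in>C. c b *\<^sub>R b)"
    have s: "s \<in> span C"
      unfolding s_def by (intro span_sum span_scale span_base)
    have ws: "c y *\<^sub>R y + s \<in> W"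
      using * fin yC by (simp add: s_def)
    have cy: "c y = 0"
    proof (rule ccontr)
      assume c: "c y \<noteq> 0"
      \<comment> \<open>If the coefficient of y were nonzero, the relation could be solved for y,
        placing y in \<open>span C\<close> modulo \<open>W\<close>.\<close>
      have "y - (- (1 / c y)) *\<^sub>R s = (1 / c y) *\<^sub>R (c y *\<^sub>R y + s)"
        using c by (simp add: scaleR_right_distrib)
      moreover have "\<dots> \<in> W"
        using W ws by (rule subspace_scale)
      ultimately have "y - (- (1 / c y)) *\<^sub>R s \<in> W"
        by simp
      then show False
        using y span_scale[OF s] by blast
    qed
    then show ?thesis
      using ws C unfolding s_def mod_indep_def by auto
  qed
  then show "mod_indep W (insert y C)"
    using fin by (auto simp: mod_indep_def)
qed

text \<open>Vectors are added while \<open>C\<close> fails to generate; the gap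
  \<open>card B - card C\<close> decreases, since no independent set modulo \<open>W\<close>
  outgrows the generating set \<open>B\<close>.\<close>

lemma mod_indep_extend:
  assumes W: "subspace W" and C: "mod_indep W C" and B: "mod_span W B"
  obtains D where "C \<subseteq> D" "quotient_basis W D"
proof -
  have "\<exists>D. C \<subseteq> D \<and> quotient_basis W D"
    using C
  proof (induction "card B - card C" arbitrary: C rule: less_induct)
    case less
    show ?case
    proof (cases "mod_span W C")
      case True
      then show ?thesis using less.prems by (auto simp: quotient_basis_iff)
    next
      case False
      then obtain y where y: "\<And>v. v \<in> span C \<Longrightarrow> y - v \<notin> W"
        using less.prems unfolding mod_span_def mod_indep_def by auto
      note ins = mod_indep_insert[OF W less.prems y]
      have "finite C"
        using less.prems by (simp add: mod_indep_def)
      then have "card (insert y C) = Suc (card C)"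
        using ins by simp
      moreover have "card (insert y C) \<le> card B"
        using mod_indep_card_le[OF W ins(2) B] .
      ultimately have "card B - card (insert y C) < card B - card C"
        by simp
      from less.hyps[OF this ins(2)] show ?thesis by blast
    qed
  qed
  then show thesis using that by blast
qed

lemma mod_indep_empty: "mod_indep W {}"
  by (simp add: mod_indep_def)

text \<open>Makes infinite codimension tractable: there, an independent set of size k serves as a
  finite certificate that the codimension is at least k, and such a certificate can be
  perturbed.\<close>

lemma quotient_basis_or_large_indep:
  assumes W: "subspace W"
  obtains D where "quotient_basis W D" | C where "mod_indep W C" "card C = k"
proof (cases "\<exists>D. quotient_basis W D")
  case False
  have "\<exists>C. mod_indep W C \<and> card C = k"
  proof (induction k)
    case 0
    then show ?case using mod_indep_empty by (metis card.empty)
  next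
    case (Suc k)
    then obtain C where C: "mod_indep W C" "card C = k" by blast
    then have "\<not> mod_span W C"
      using False by (auto simp: quotient_basis_iff)
    then obtain y where y: "\<And>v. v \<in> span C \<Longrightarrow> y - v \<notin> W"
      using C unfolding mod_span_def mod_indep_def by auto
    note ins = mod_indep_insert[OF W C(1) y]
    have "finite C"
      using C by (simp add: mod_indep_def)
    then show ?case
      using ins C by (metis card_insert_disjoint)
  qed
  then show thesis using that by blast
qed (use that in blast)

lemma mod_indep_independent: "subspace W \<Longrightarrow> mod_indep W B \<Longrightarrow> independent B"
  unfolding mod_indep_def by (auto simp: dependent_finite subspace_0)

lemma mod_indep_of_independent:
  assumes "finite B" "independent B" "span B \<inter> W \<subseteq> {0}"
  shows "mod_indep W B"
  unfolding mod_indep_def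
proof (intro conjI allI impI ballI)
  fix c b assume *: "(\<Sum>b\<in>B. c b *\<^sub>R b) \<in> W" "b \<in> B"
  have "(\<Sum>b\<in>B. c b *\<^sub>R b) \<in> span B"
    by (intro span_sum span_scale span_base)
  then have "(\<Sum>b\<in>B. c b *\<^sub>R b) = 0"
    using * assms(3) by blast
  then show "c b = 0"
    using assms * by (metis dependent_finite)
qed (fact assms(1))

lemma mod_indep_mono:
  assumes B: "mod_indep W B" and "C \<subseteq> B"
  shows "mod_indep W C"
proof (rule mod_indepI)
  have fin: "finite B"
    using B by (simp add: mod_indep_def)
  then show "finite C"
    using \<open>C \<subseteq> B\<close> by (rule rev_finite_subset)
  fix c b assume *: "(\<Sum>b\<in>C. c b *\<^sub>R b) \<in> W" "b \<in> C"
  let ?d = "\<lambda>b. if b \<in> C then c b else 0"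
  have "(\<Sum>b\<in>B. ?d b *\<^sub>R b) = (\<Sum>b\<in>C. c b *\<^sub>R b)"
    using fin \<open>C \<subseteq> B\<close> by (intro sum.mono_neutral_cong_right) auto
  then have "?d b = 0"
    using mod_indepD[OF B, of ?d b] * \<open>C \<subseteq> B\<close> by auto
  then show "c b = 0" using * by simp
qed

lemma span_meets_trivially:
  assumes "mod_indep W B" "v \<in> span B" "v \<in> W"
  shows "v = 0"
proof -
  obtain c where "v = (\<Sum>b\<in>B. c b *\<^sub>R b)"
    using assms by (auto simp: mod_indep_def span_finite)
  then show ?thesis
    using assms by (auto simp: mod_indep_def)
qed

section \<open>Kernel, range and index of a linear map that is injective on a subspace of finite
  codimension\<close>

lemma kernel_finite_basis:
  assumes "linear T" "subspace E" and inj: "\<And>x. x \<in> E \<Longrightarrow> T x = 0 \<Longrightarrow> x = 0"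
    and U: "mod_span E U"
  obtains K where "span K = {x. T x = 0}" "independent K" "mod_indep E K" "card K \<le> card U"
proof -
  have sub: "subspace {x. T x = 0}"
    using \<open>linear T\<close> by (rule linear_subspace_kernel)
  obtain K where K: "K \<subseteq> {x. T x = 0}" "independent K" "{x. T x = 0} \<subseteq> span K"
    using maximal_independent_subset[of "{x. T x = 0}"] by blast
  have sp: "span K = {x. T x = 0}"
    using K sub by (metis span_subspace)
  \<comment> \<open>The kernel meets \<open>E\<close> only in 0, so independence in the kernel is
    independence modulo \<open>E\<close>. Hence every finite part of \<open>K\<close> has at most
    \<open>card U\<close> elements, and \<open>K\<close> is finite.\<close>
  have ind: "mod_indep E C" if "finite C" "C \<subseteq> K" for C
  proof (rule mod_indep_of_independent)
    show "independent C"
      using K that by (metis dependent_mono)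
    show "span C \<inter> E \<subseteq> {0}"
      using inj sp span_mono[OF that(2)] by auto
  qed (fact that)
  have "finite K"
  proof (rule ccontr)
    assume "infinite K"
    then obtain C where C: "C \<subseteq> K" "finite C" "card C = Suc (card U)"
      using infinite_arbitrarily_large by blast
    then show False
      using mod_indep_card_le[OF \<open>subspace E\<close> ind U] by fastforce
  qed
  then have "mod_indep E K"
    using ind by blast
  then show thesis
    using that sp K(2) mod_indep_card_le[OF \<open>subspace E\<close> _ U] by blast
qed

text \<open>Finite codimension of the range passes to \<open>T\<close>
  E\<open>: modulo the range y is some d, and the remaining\<close>T
  x\<open>differs from an element of\<close>T \<open>E\<close> by some T u with u in
  \<open>span U\<close>.\<close>

lemma range_mod_span:
  assumes "linear T" "mod_span E U" "mod_span (range T) D"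
  obtains V where "mod_span (T ` E) V"
proof
  have fin: "finite U" "finite D"
    using assms(2,3) unfolding mod_span_def by blast+
  have "\<exists>v\<in>span (T ` U \<union> D). y - v \<in> T ` E" for y
  proof -
    obtain d x where d: "d \<in> span D" "y - d = T x"
      using assms(3) unfolding mod_span_def by blast
    obtain u where u: "u \<in> span U" "x - u \<in> E"
      using assms(2) unfolding mod_span_def by blast
    have "T u \<in> span (T ` U)"
      using u linear_span_image[OF \<open>linear T\<close>] by blast
    then have "T u + d \<in> span (T ` U \<union> D)"
      using d by (metis in_mono span_add span_mono sup_ge1 sup_ge2)
    moreover have "y - (T u + d) = T (x - u)"
      using d by (simp add: linear_diff[OF \<open>linear T\<close>] algebra_simps)
    ultimately show ?thesis
      using u by (metis imageI)
  qed
  then show "mod_span (T ` E) (T ` U \<union> D)"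
    using fin by (auto simp: mod_span_def)
qed

text \<open>Completing a basis \<open>K\<close> of the kernel by \<open>C\<close> to a basis modulo \<open>E\<close>, and \<open>T ` C\<close> by \<open>D\<close> to
  one modulo \<open>T ` E\<close>, makes \<open>D\<close> a basis modulo \<open>range T\<close>.\<close>

lemma index_formula:
  assumes "linear T" and E: "subspace E" and inj: "\<And>x. x \<in> E \<Longrightarrow> T x = 0 \<Longrightarrow> x = 0"
    and U: "quotient_basis E U" and V: "quotient_basis (T ` E) V"
  obtains K D where "finite K" "independent K" "span K = {x. T x = 0}" "quotient_basis (range T) D"
    "card K + card V = card D + card U"
proof -
  note lin = linear_0[OF \<open>linear T\<close>] linear_add[OF \<open>linear T\<close>] linear_diff[OF \<open>linear T\<close>] linear_sum[OF \<open>linear T\<close>] linear_scale[OF \<open>linear T\<close>]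
  have TE: "subspace (T ` E)"
    using \<open>linear T\<close> E by (rule linear_subspace_image)
  obtain K where K: "span K = {x. T x = 0}" "independent K" "mod_indep E K" "card K \<le> card U"
    using kernel_finite_basis[OF \<open>linear T\<close> E inj] U by (auto simp: quotient_basis_iff)
  obtain B where B: "K \<subseteq> B" "quotient_basis E B"
    using mod_indep_extend[OF E K(3)] U by (auto simp: quotient_basis_iff)
  define C where "C = B - K"
  have fin: "finite B" "finite K" "finite C"
    using B K by (auto simp: mod_indep_def quotient_basis_def C_def)
  have TC0: "\<forall>b\<in>C. c b = 0" if mem: "T (\<Sum>b\<in>C. c b *\<^sub>R b) \<in> T ` E" for c
  proof -
    obtain e where e: "e \<in> E" "T (\<Sum>b\<in>C. c b *\<^sub>R b) = T e"
      using mem by blast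
    then have "(\<Sum>b\<in>C. c b *\<^sub>R b) - e \<in> span K"
      by (simp add: K lin)
    then obtain d where d: "(\<Sum>b\<in>C. c b *\<^sub>R b) - e = (\<Sum>b\<in>K. d b *\<^sub>R b)"
      using fin by (auto simp: span_finite)
    let ?f = "\<lambda>b. if b \<in> C then c b else - d b"
    have "(\<Sum>b\<in>B. ?f b *\<^sub>R b) = (\<Sum>b\<in>C. ?f b *\<^sub>R b) + (\<Sum>b\<in>K. ?f b *\<^sub>R b)"
      unfolding C_def using B(1) fin by (metis (no_types, lifting) sum.subset_diff)
    also have "(\<Sum>b\<in>C. ?f b *\<^sub>R b) = (\<Sum>b\<in>C. c b *\<^sub>R b)"
      by (intro sum.cong) auto
    also have "(\<Sum>b\<in>K. ?f b *\<^sub>R b) = - (\<Sum>b\<in>K. d b *\<^sub>R b)"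
      unfolding sum_negf[symmetric] by (intro sum.cong) (auto simp: C_def)
    finally have "(\<Sum>b\<in>B. ?f b *\<^sub>R b) = e"
      using d by (simp add: algebra_simps)
    then have "?f b = 0" if "b \<in> B" for b
      using mod_indepD[of E B ?f b] B(2) e(1) that by (simp add: quotient_basis_iff)
    then show ?thesis
      unfolding C_def by force
  qed
  have "inj_on T C"
  proof (rule inj_onI, rule ccontr)
    fix x y assume xy: "x \<in> C" "y \<in> C" "T x = T y" "x \<noteq> y"
    let ?c = "\<lambda>b. (if b = x then 1 else 0) - (if b = y then 1 else (0::real))"
    have "(\<Sum>b\<in>C. ?c b *\<^sub>R b) = x - y"
      using sum_delta_diff[OF fin(3) xy(1,2), of "\<lambda>b. b"] by simp
    then have "T (\<Sum>b\<in>C. ?c b *\<^sub>R b) = T 0"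
      using xy by (simp add: lin)
    then have "T (\<Sum>b\<in>C. ?c b *\<^sub>R b) \<in> T ` E"
      using imageI[OF subspace_0[OF E], of T] by simp
    from bspec[OF TC0[OF this] xy(1)] have "?c x = 0" .
    then show False
      using xy by simp
  qed
  then have cTC: "card (T ` C) = card C"
    by (rule card_image)
  have "mod_indep (T ` E) (T ` C)"
    unfolding mod_indep_def
  proof (intro conjI allI impI)
    fix c assume "(\<Sum>b\<in>T ` C. c b *\<^sub>R b) \<in> T ` E"
    then have "T (\<Sum>b\<in>C. (c \<circ> T) b *\<^sub>R b) \<in> T ` E"
      using \<open>inj_on T C\<close> by (simp add: sum.reindex lin)
    from TC0[OF this] show "\<forall>b\<in>T ` C. c b = 0"
      by simp
  qed (use fin in auto)
  then obtain G where G: "T ` C \<subseteq> G" "quotient_basis (T ` E) G"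
    using mod_indep_extend[OF TE] V by (metis quotient_basis_iff)
  define D where "D = G - T ` C"
  have finG: "finite G" "finite D"
    using G by (auto simp: quotient_basis_def D_def)
  have "mod_indep (range T) D"
    unfolding mod_indep_def
  proof (intro conjI allI impI)
    fix c assume "(\<Sum>b\<in>D. c b *\<^sub>R b) \<in> range T"
    then obtain x where x: "(\<Sum>b\<in>D. c b *\<^sub>R b) = T x" by auto
    obtain u where u: "u \<in> span B" "x - u \<in> E"
      using B(2) unfolding quotient_basis_iff mod_span_def by blast
    have "B = C \<union> K"
      using B(1) by (auto simp: C_def)
    \<comment> \<open>The kernel part of u disappears under T, so T x lies in the span of
      \<open>T\<close> C\<open>modulo\<close>T \<open>E\<close>; a relation of \<open>D\<close>
      modulo the range thus becomes one in the basis \<open>G\<close>.\<close>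
    then have "u \<in> span (C \<union> K)"
      using u by simp
    then obtain u1 u2 where u12: "u = u1 + u2" "u1 \<in> span C" "u2 \<in> span K"
      by (auto simp: span_Un)
    have "T u \<in> span (T ` C)"
      using u12 K by (auto simp: lin linear_span_image[OF \<open>linear T\<close>])
    then obtain d where d: "T u = (\<Sum>b\<in>T ` C. d b *\<^sub>R b)"
      using fin by (auto simp: span_finite)
    let ?f = "\<lambda>b. if b \<in> D then c b else - d b"
    have "(\<Sum>b\<in>G. ?f b *\<^sub>R b) = (\<Sum>b\<in>D. ?f b *\<^sub>R b) + (\<Sum>b\<in>T ` C. ?f b *\<^sub>R b)"
      unfolding D_def using G(1) finG by (metis (no_types, lifting) sum.subset_diff)
    also have "(\<Sum>b\<in>D. ?f b *\<^sub>R b) = (\<Sum>b\<in>D. c b *\<^sub>R b)"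
      by (intro sum.cong) auto
    also have "(\<Sum>b\<in>T ` C. ?f b *\<^sub>R b) = - (\<Sum>b\<in>T ` C. d b *\<^sub>R b)"
      unfolding sum_negf[symmetric] by (intro sum.cong) (auto simp: D_def)
    finally have "(\<Sum>b\<in>G. ?f b *\<^sub>R b) = T (x - u)"
      using d x by (simp add: lin algebra_simps)
    then have "?f b = 0" if "b \<in> G" for b
      using mod_indepD[of "T ` E" G ?f b] G(2) u(2) that by (simp add: quotient_basis_iff)
    then show "\<forall>b\<in>D. c b = 0"
      unfolding D_def by force
  qed (fact finG)
  moreover have "mod_span (range T) D"
    unfolding mod_span_def
  proof (intro conjI allI)
    fix y
    obtain g where g: "g \<in> span G" "y - g \<in> T ` E"
      using G(2) unfolding quotient_basis_iff mod_span_def by blast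
    have "G = D \<union> T ` C"
      using G(1) by (auto simp: D_def)
    then have "g \<in> span (D \<union> T ` C)"
      using g by simp
    then obtain g1 g2 where g12: "g = g1 + g2" "g1 \<in> span D" "g2 \<in> T ` span C"
      by (auto simp: span_Un linear_span_image[OF \<open>linear T\<close>])
    have "y - g1 = (y - g) + g2"
      using g12 by simp
    moreover have "y - g \<in> range T" "g2 \<in> range T"
      using g g12 by auto
    ultimately have "y - g1 \<in> range T"
      by (metis \<open>linear T\<close> linear_subspace_image subspace_UNIV subspace_add)
    then show "\<exists>v\<in>span D. y - v \<in> range T"
      using g12 by blast
  qed (fact finG)
  \<comment> \<open>Both sides equal \<open>card D + card C + card K\<close>.\<close>
  moreover have "card K + card V = card D + card U"
  proof -
    have "card G = card D + card C"
      using G(1) finG cTC card_mono[OF finG(1) G(1)] fin unfolding D_def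
      by (simp add: card_Diff_subset)
    moreover have "card U = card C + card K"
      using quotient_basis_card_eq[OF E U B(2)] B(1) fin card_mono[OF fin(1) B(1)] unfolding C_def
      by (simp add: card_Diff_subset)
    moreover have "card V = card G"
      using quotient_basis_card_eq[OF TE V G(2)] .
    ultimately show ?thesis by simp
  qed
  ultimately show thesis
    using that fin K by (auto simp: quotient_basis_iff)
qed

section \<open>The Hahn--Banach theorem\<close>

text \<open>Homogeneity is asked only as an inequality, the form in which it passes to infima.
  Equality is recovered in \<open>sublinear_scale\<close> by using the factor 1 / t as well.\<close>

definition sublinear :: "('a::real_vector \<Rightarrow> real) \<Rightarrow> bool" where
  "sublinear p \<longleftrightarrow> (\<forall>x y. p (x + y) \<le> p x + p y) \<and> (\<forall>x. \<forall>t>0. p (t *\<^sub>R x) \<le> t * p x)"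

lemma sublinear_scale:
  assumes "sublinear p" "0 \<le> t"
  shows "p (t *\<^sub>R x) = t * p x"
proof -
  have le: "p (s *\<^sub>R y) \<le> s * p y" if "0 < s" for s y
    using assms that by (simp add: sublinear_def)
  have eq: "p (s *\<^sub>R y) = s * p y" if "0 < s" for s y
    using le[of s y] le[of "1 / s" "s *\<^sub>R y"] that by (simp add: field_simps)
  have "p 0 = 0"
    using eq[of 2 0] by simp
  then show ?thesis
    using eq[of t x] \<open>0 \<le> t\<close> by (cases "t = 0") auto
qed

lemma sublinear_minus_le: "sublinear p \<Longrightarrow> - p (- x) \<le> p x"
  using sublinear_scale[of p 0 x] unfolding sublinear_def
  by (metis add.right_inverse add_le_cancel_right le_add_same_cancel2 mult_zero_left neg_le_iff_le
      order_refl scaleR_zero_left le_minus_iff diff_ge_0_iff_ge diff_minus_eq_add minus_minus)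

text \<open>The largest sublinear minorant of \<open>p\<close> that is at most \<open>- p y\<close> at \<open>- y\<close>.\<close>

lemma sublinear_minorant:
  fixes p :: "'a::real_vector \<Rightarrow> real"
  assumes p: "sublinear p"
  obtains q where "sublinear q" "\<And>x. q x \<le> p x" "\<And>x t. 0 \<le> t \<Longrightarrow> q x \<le> p (x + t *\<^sub>R y) - t * p y"
proof
  let ?h = "\<lambda>x t. p (x + t *\<^sub>R y) - t * p y"
  let ?q = "\<lambda>x. INF t\<in>{0..}. ?h x t"
  have sub: "p (a + b) \<le> p a + p b" for a b
    using p by (simp add: sublinear_def)
  \<comment> \<open>Keeps the infimum finite: t * p y = p (t y) is at most p (x + t y) + p (- x) by
    subadditivity.\<close>
  have lower: "- p (- x) \<le> ?h x t" if "0 \<le> t" for x t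
    using sub[of "x + t *\<^sub>R y" "- x"] sublinear_scale[OF p that, of y] by simp
  have bdd: "bdd_below (?h x ` {0..})" for x
    using lower by (intro bdd_belowI[of _ "- p (- x)"]) auto
  show le: "?q x \<le> ?h x t" if "0 \<le> t" for x t
    using bdd that by (intro cINF_lower) auto
  show "?q x \<le> p x" for x
    using le[of 0 x] by simp
  show "sublinear ?q"
    unfolding sublinear_def
  proof (intro conjI allI impI)
    fix x z
    have *: "?q (x + z) \<le> ?h x s + ?h z t" if "0 \<le> s" "0 \<le> t" for s t
    proof -
      have "?q (x + z) \<le> ?h (x + z) (s + t)"
        using le that by simp
      also have "\<dots> \<le> ?h x s + ?h z t"
        using sub[of "x + s *\<^sub>R y" "z + t *\<^sub>R y"] by (simp add: algebra_simps)
      finally show ?thesis .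
    qed
    have "?q (x + z) - ?h x s \<le> ?q z" if "0 \<le> s" for s
    proof (rule cINF_greatest)
      fix t :: real assume "t \<in> {0..}"
      then show "?q (x + z) - ?h x s \<le> ?h z t"
        using *[of s t] that by simp
    qed simp
    then have "?q (x + z) - ?q z \<le> ?h x s" if "0 \<le> s" for s
      using that by (smt (verit))
    then have "?q (x + z) - ?q z \<le> ?q x"
      by (intro cINF_greatest) auto
    then show "?q (x + z) \<le> ?q x + ?q z"
      by simp
  next
    fix x and r :: real assume r: "0 < r"
    have "?q (r *\<^sub>R x) / r \<le> ?h x t" if "0 \<le> t" for t
    proof -
      have "?q (r *\<^sub>R x) \<le> ?h (r *\<^sub>R x) (r * t)"
        using le that r by simp
      also have "\<dots> = r * ?h x t"
        using sublinear_scale[OF p, of r "x + t *\<^sub>R y"] r by (simp add: algebra_simps)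
      finally show ?thesis
        using r by (simp add: field_simps)
    qed
    then have "?q (r *\<^sub>R x) / r \<le> ?q x"
      by (intro cINF_greatest) auto
    then show "?q (r *\<^sub>R x) \<le> r * ?q x"
      using r by (simp add: field_simps)
  qed
qed

text \<open>Supplies the lower bounds of chains for Zorn's lemma. The pointwise infimum is finite
  because every sublinear q below p is at least - p (- x) at x.\<close>

lemma sublinear_INF:
  fixes p :: "'a::real_vector \<Rightarrow> real"
  assumes "C \<noteq> {}" and C: "\<And>q. q \<in> C \<Longrightarrow> sublinear q \<and> q \<le> p"
    and chain: "\<And>q r. q \<in> C \<Longrightarrow> r \<in> C \<Longrightarrow> q \<le> r \<or> r \<le> q"
  obtains u where "sublinear u" "\<And>q. q \<in> C \<Longrightarrow> u \<le> q"
proof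
  let ?u = "\<lambda>x. INF q\<in>C. q x"
  have "- p (- x) \<le> q x" if "q \<in> C" for q x
    using sublinear_minus_le[of q x] C[OF that] by (force simp: le_fun_def intro: order_trans[of _ "- q (- x)"])
  then have bdd: "bdd_below ((\<lambda>q. q x) ` C)" for x
    by (intro bdd_belowI[of _ "- p (- x)"]) auto
  have le: "?u x \<le> q x" if "q \<in> C" for q x
    using bdd that by (intro cINF_lower) auto
  then show "?u \<le> q" if "q \<in> C" for q
    using that by (simp add: le_fun_def)
  show "sublinear ?u"
    unfolding sublinear_def
  proof (intro conjI allI impI)
    fix x z
    have *: "?u (x + z) \<le> q x + r z" if qr: "q \<in> C" "r \<in> C" for q r
    proof -
      \<comment> \<open>Subadditivity of the infimum needs one function for both arguments; in a
        chain the smaller of q and r serves.\<close>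
      obtain s where s: "s \<in> C" "s \<le> q" "s \<le> r"
        using chain qr by blast
      have "?u (x + z) \<le> s x + s z"
        using order_trans[OF le[OF s(1), of "x + z"]] C[OF s(1)] unfolding sublinear_def by blast
      also have "\<dots> \<le> q x + r z"
        using s(2,3) by (intro add_mono) (auto simp: le_fun_def)
      finally show ?thesis .
    qed
    have "?u (x + z) - q x \<le> ?u z" if "q \<in> C" for q
    proof (rule cINF_greatest[OF \<open>C \<noteq> {}\<close>])
      show "?u (x + z) - q x \<le> r z" if "r \<in> C" for r
        using *[OF \<open>q \<in> C\<close> that] by simp
    qed
    then have "?u (x + z) - ?u z \<le> q x" if "q \<in> C" for q
      using that by (smt (verit))
    then have "?u (x + z) - ?u z \<le> ?u x"
      using \<open>C \<noteq> {}\<close> by (intro cINF_greatest) auto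
    then show "?u (x + z) \<le> ?u x + ?u z"
      by simp
  next
    fix x and r :: real assume r: "0 < r"
    have "?u (r *\<^sub>R x) / r \<le> q x" if "q \<in> C" for q
      using le[OF that, of "r *\<^sub>R x"] sublinear_scale[of q r x] C[OF that] r by (simp add: field_simps)
    then have "?u (r *\<^sub>R x) / r \<le> ?u x"
      using \<open>C \<noteq> {}\<close> by (intro cINF_greatest) auto
    then show "?u (r *\<^sub>R x) \<le> r * ?u x"
      using r by (simp add: field_simps)
  qed
qed

text \<open>A minimal sublinear functional is additive: it equals each of its minorants from
  \<open>sublinear_minorant\<close>.\<close>

lemma sublinear_dominates_linear:
  fixes p :: "'a::real_vector \<Rightarrow> real"
  assumes p: "sublinear p"
  obtains f where "linear f" "f \<le> p"
proof -
  define S where "S = {q. sublinear q \<and> q \<le> p}"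
  have "\<exists>m\<in>S. \<forall>q\<in>S. q \<le> m \<longrightarrow> q = m"
  proof (rule predicate_Zorn)
    show "partial_order_on S (relation_of (\<lambda>x y. y \<le> x) S)"
      by (auto simp: partial_order_on_def preorder_on_def refl_on_def trans_def antisym_def relation_of_def)
    fix C assume "C \<in> Chains (relation_of (\<lambda>x y. y \<le> x) S)"
    then have C: "\<And>q r. q \<in> C \<Longrightarrow> r \<in> C \<Longrightarrow> q \<in> S \<and> (q \<le> r \<or> r \<le> q)"
      by (auto simp: Chains_def relation_of_def)
    show "\<exists>u\<in>S. \<forall>a\<in>C. u \<le> a"
    proof (cases "C = {}")
      case True
      then show ?thesis using p by (auto simp: S_def)
    next
      case False
      obtain u where u: "sublinear u" "\<And>q. q \<in> C \<Longrightarrow> u \<le> q"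
        by (rule sublinear_INF[OF False, of p]) (use C S_def in auto)
      then have "u \<le> p"
        using False C unfolding S_def by (metis (mono_tags, lifting) ex_in_conv mem_Collect_eq order_trans)
      then show ?thesis
        using u by (auto simp: S_def)
    qed
  qed
  then obtain m where m: "sublinear m" "m \<le> p" and min: "\<And>q. sublinear q \<Longrightarrow> q \<le> m \<Longrightarrow> q = m"
    unfolding S_def by (blast intro: order_trans)
  have add: "m (x + y) = m x + m y" for x y
  proof -
    obtain q where q: "sublinear q" "\<And>x. q x \<le> m x"
      "\<And>x t. 0 \<le> t \<Longrightarrow> q x \<le> m (x + t *\<^sub>R y) - t * m y"
      using sublinear_minorant[OF m(1), of y] by blast
    have "q = m"
      using min q by (simp add: le_fun_def)
    \<comment> \<open>Minimality with t = 1 gives the reverse of subadditivity.\<close>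
    then have "m x \<le> m (x + y) - m y"
      using q(3)[of 1 x] by simp
    then show ?thesis
      using m(1) unfolding sublinear_def by (smt (verit))
  qed
  have "m (- x) = - m x" for x
    using add[of x "- x"] sublinear_scale[OF m(1), of 0 x] by simp
  then have "m (t *\<^sub>R x) = t * m x" for t x
    using sublinear_scale[OF m(1), of t x] sublinear_scale[OF m(1), of "- t" x] by (cases "0 \<le> t") auto
  then have "linear m"
    using add by (intro linearI) auto
  then show thesis
    using that m by blast
qed

text \<open>The linear functional is taken below the minorant of \<open>sublinear_minorant\<close>,
  whose value at - y is at most - p y. This forces equality at y.\<close>

lemma Hahn_Banach_sublinear:
  fixes p :: "'a::real_vector \<Rightarrow> real"
  assumes p: "sublinear p"
  obtains f where "linear f" "\<And>x. f x \<le> p x" "f y = p y"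
proof -
  obtain q where q: "sublinear q" "\<And>x. q x \<le> p x"
    "\<And>x t. 0 \<le> t \<Longrightarrow> q x \<le> p (x + t *\<^sub>R y) - t * p y"
    using sublinear_minorant[OF p, of y] by blast
  obtain f where f: "linear f" "f \<le> q"
    using sublinear_dominates_linear[OF q(1)] by blast
  have "f (- y) \<le> - p y"
    using f(2) q(3)[of 1 "- y"] sublinear_scale[OF p, of 0 y] by (auto simp: le_fun_def intro: order_trans)
  then have "p y \<le> f y"
    using f(1) by (simp add: linear_neg)
  moreover have "f x \<le> p x" for x
    using f(2) q(2) by (auto simp: le_fun_def intro: order_trans)
  ultimately show thesis
    using that f(1) by (meson antisym)
qed

lemma Hahn_Banach_normed:
  fixes p :: "'a::real_normed_vector \<Rightarrow> real"
  assumes p: "sublinear p" and le: "\<And>x. p x \<le> norm x"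
  obtains \<phi> :: "'a \<Rightarrow>\<^sub>L real" where "\<And>x. blinfun_apply \<phi> x \<le> p x" "blinfun_apply \<phi> y = p y" "norm \<phi> \<le> 1"
proof -
  obtain f where f: "linear f" "\<And>x. f x \<le> p x" "f y = p y"
    using Hahn_Banach_sublinear[OF p, of y] by blast
  have abs: "\<bar>f x\<bar> \<le> norm x" for x
    using f(2)[of x] f(2)[of "- x"] le[of x] le[of "- x"] linear_neg[OF f(1), of x] by auto
  have bl: "bounded_linear f"
  proof (rule bounded_linear_intro[where K = 1])
    show "f (x + y) = f x + f y" for x y
      using f(1) by (rule linear_add)
    show "f (r *\<^sub>R x) = r *\<^sub>R f x" for r x
      using f(1) by (rule linear_scale)
  qed (use abs in auto)
  then have app: "blinfun_apply (Blinfun f) = f"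
    by (rule bounded_linear_Blinfun_apply)
  have "norm (Blinfun f) \<le> 1"
    by (rule norm_blinfun_bound) (auto simp: app abs)
  then show thesis
    using that[of "Blinfun f"] f app by simp
qed

lemma norming_functional:
  fixes y :: "'a::real_normed_vector"
  obtains \<phi> :: "'a \<Rightarrow>\<^sub>L real" where "norm \<phi> \<le> 1" "blinfun_apply \<phi> y = norm y"
proof -
  have "sublinear (norm :: 'a \<Rightarrow> real)"
    by (auto simp: sublinear_def norm_triangle_ineq)
  from Hahn_Banach_normed[OF this, of y] show thesis
    using that by auto
qed

text \<open>Hahn--Banach applied to the distance from \<open>W\<close>, a sublinear function that
  vanishes on \<open>W\<close> and, \<open>W\<close> being closed, is positive at b; the functional
  is then rescaled.\<close>

lemma separating_functional:
  fixes W :: "'a::real_normed_vector set"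
  assumes W: "subspace W" "closed W" and b: "b \<notin> W"
  obtains \<phi> :: "'a \<Rightarrow>\<^sub>L real" where "blinfun_apply \<phi> b = 1" "\<And>w. w \<in> W \<Longrightarrow> blinfun_apply \<phi> w = 0"
proof -
  have ne: "W \<noteq> {}" and W0: "0 \<in> W"
    using W(1) subspace_0 by auto
  have INF: "infdist x W = (INF w\<in>W. dist x w)" for x
    using ne by (simp add: infdist_notempty)
  have "sublinear (\<lambda>x. infdist x W)"
    unfolding sublinear_def
  proof (intro conjI allI impI)
    fix x y
    have "infdist (x + y) W \<le> dist x v + dist y w" if "v \<in> W" "w \<in> W" for v w
    proof -
      have "infdist (x + y) W \<le> dist (x + y) (v + w)"
        using that W(1) by (intro infdist_le subspace_add)
      also have "\<dots> \<le> dist x v + dist y w"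
        by (rule dist_triangle_add)
      finally show ?thesis .
    qed
    then have "infdist (x + y) W - dist x v \<le> infdist y W" if "v \<in> W" for v
      unfolding INF[of y] using that ne by (intro cINF_greatest) (auto simp: algebra_simps)
    then have "infdist (x + y) W - infdist y W \<le> infdist x W"
      unfolding INF[of x] using ne by (intro cINF_greatest) (auto simp: algebra_simps)
    then show "infdist (x + y) W \<le> infdist x W + infdist y W"
      by simp
  next
    fix x and t :: real assume t: "0 < t"
    have "infdist (t *\<^sub>R x) W / t \<le> dist x w" if "w \<in> W" for w
    proof -
      have "infdist (t *\<^sub>R x) W \<le> dist (t *\<^sub>R x) (t *\<^sub>R w)"
        using that W(1) by (intro infdist_le subspace_scale)
      also have "\<dots> = t * dist x w"
        using t by (simp add: dist_norm flip: scaleR_diff_right)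
      finally show ?thesis
        using t by (simp add: field_simps)
    qed
    then have "infdist (t *\<^sub>R x) W / t \<le> infdist x W"
      unfolding INF[of x] using ne by (intro cINF_greatest) auto
    then show "infdist (t *\<^sub>R x) W \<le> t * infdist x W"
      using t by (simp add: field_simps)
  qed
  moreover have "infdist x W \<le> norm x" for x
    using infdist_le[OF W0, of x] by simp
  ultimately obtain \<phi> :: "'a \<Rightarrow>\<^sub>L real"
    where \<phi>: "\<And>x. blinfun_apply \<phi> x \<le> infdist x W" "blinfun_apply \<phi> b = infdist b W"
    using Hahn_Banach_normed[of "\<lambda>x. infdist x W" b] by blast
  have pos: "infdist b W > 0"
    using W(2) ne b by (rule infdist_pos_not_in_closed)
  have "blinfun_apply \<phi> w = 0" if "w \<in> W" for w
  proof -
    have "- w \<in> W"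
      using that W(1) by (simp add: subspace_neg)
    then show ?thesis
      using that \<phi>(1)[of w] \<phi>(1)[of "- w"] by (simp add: blinfun.minus_right)
  qed
  then show thesis
    using that[of "(1 / infdist b W) *\<^sub>R \<phi>"] \<phi>(2) pos by (simp add: blinfun.scaleR_left)
qed

section \<open>Operators with closed range\<close>

text \<open>The Baire half of the open mapping theorem, inside the closed and hence complete range:
  it is the union of the closures of the images of balls, so one of these closures contains a
  relative ball.\<close>

lemma open_mapping_approximation:
  fixes A :: "'a::banach \<Rightarrow>\<^sub>L 'b::banach"
  assumes "closed (range (blinfun_apply A))"
  obtains M where "0 \<le> M"
    "\<And>y. y \<in> range (blinfun_apply A) \<Longrightarrow> \<exists>x. norm x \<le> M * norm y \<and> norm (y - blinfun_apply A x) \<le> norm y / 2"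
proof -
  define R where "R = range (blinfun_apply A)"
  have R: "subspace R" "closed R"
    using assms unfolding R_def
    by (auto intro!: linear_subspace_image subspace_UNIV bounded_linear.linear blinfun.bounded_linear_right)
  let ?X = "top_of_set R"
  let ?G = "\<lambda>n::nat. R \<inter> closure (blinfun_apply A ` cball 0 (real n))"
  have compl: "completely_metrizable_space ?X"
    using R(2) by (simp add: completely_metrizable_space_closedin completely_metrizable_space_euclidean)
  have "\<exists>n. ?X interior_of ?G n \<noteq> {}"
  proof (rule ccontr)
    assume "\<nexists>n. ?X interior_of ?G n \<noteq> {}"
    then have empty: "?X interior_of ?G n = {}" for n by blast
    have "?X interior_of \<Union>(range ?G) = {}"
      by (rule Baire_category_alt) (use compl empty in \<open>auto simp: closedin_closed_Int\<close>)
    moreover have "\<Union>(range ?G) = R"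
    proof -
      have "blinfun_apply A x \<in> \<Union>(range ?G)" for x
      proof -
        obtain n where "norm x \<le> real n"
          using real_arch_simple by blast
        then have "blinfun_apply A x \<in> ?G n"
          unfolding R_def using closure_subset by fastforce
        then show ?thesis by blast
      qed
      then show ?thesis
        unfolding R_def by blast
    qed
    ultimately have "R = {}"
      by (metis interior_of_topspace topspace_euclidean_subtopology)
    then show False
      by (auto simp: R_def)
  qed
  then obtain n y0 where "y0 \<in> ?X interior_of ?G n" by blast
  then obtain V where V: "openin ?X V" "y0 \<in> V" "V \<subseteq> ?G n"
    by (auto simp: interior_of_def)
  then obtain r where r: "r > 0" "\<And>y. y \<in> R \<Longrightarrow> dist y y0 < r \<Longrightarrow> y \<in> V"
    unfolding openin_euclidean_subtopology_iff by (metis dist_commute)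
  have y0: "y0 \<in> R" "y0 \<in> closure (blinfun_apply A ` cball 0 (real n))"
    using V by auto
  show thesis
  proof
    show "0 \<le> 4 * real n / r"
      using r(1) by simp
    fix y assume "y \<in> range (blinfun_apply A)"
    then have y: "y \<in> R" by (simp add: R_def)
    show "\<exists>x. norm x \<le> 4 * real n / r * norm y \<and> norm (y - blinfun_apply A x) \<le> norm y / 2"
    proof (cases "y = 0")
      case True
      then show ?thesis by (intro exI[of _ 0]) (simp add: blinfun.zero_right)
    next
      case False
      \<comment> \<open>The vector s y has norm r / 2, so y0 + s y stays in the relative ball.
        Approximating it and y0 within r / 8 by images of a and b leaves an error r / 4, half of the
        norm of s y; dividing by s turns the bound 2 n for a - b into the constant 4 n / r.\<close>
      define s where "s = r / (2 * norm y)"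
      have s: "s > 0"
        using False r(1) by (simp add: s_def)
      have "y0 + s *\<^sub>R y \<in> V"
      proof (rule r(2))
        show "y0 + s *\<^sub>R y \<in> R"
          using R(1) y y0(1) by (intro subspace_add subspace_scale)
        show "dist (y0 + s *\<^sub>R y) y0 < r"
          using False r(1) by (simp add: dist_norm s_def)
      qed
      then have "y0 + s *\<^sub>R y \<in> closure (blinfun_apply A ` cball 0 (real n))"
        using V by blast
      moreover have r8: "r / 8 > 0"
        using r(1) by simp
      ultimately obtain a where a: "norm a \<le> real n" "dist (blinfun_apply A a) (y0 + s *\<^sub>R y) < r / 8"
        unfolding closure_approachable by (metis (no_types, lifting) imageE mem_cball_0)
      obtain b where b: "norm b \<le> real n" "dist (blinfun_apply A b) y0 < r / 8"
        using y0(2) r8 unfolding closure_approachable by (metis (no_types, lifting) imageE mem_cball_0)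
      let ?x = "(1 / s) *\<^sub>R (a - b)"
      have "norm (a - b) \<le> 2 * real n"
        using a(1) b(1) norm_triangle_ineq4[of a b] by linarith
      then have "norm ?x \<le> (1 / s) * (2 * real n)"
        using s by (simp add: divide_right_mono)
      moreover have "(1 / s) * (2 * real n) = 4 * real n / r * norm y"
        using False r(1) by (simp add: s_def)
      moreover have "norm (y - blinfun_apply A ?x) \<le> norm y / 2"
      proof -
        have "s *\<^sub>R (y - blinfun_apply A ?x) = s *\<^sub>R y - (blinfun_apply A a - blinfun_apply A b)"
          using s by (simp add: scaleR_diff_right blinfun.scaleR_right blinfun.diff_right)
        also have "\<dots> = ((y0 + s *\<^sub>R y) - blinfun_apply A a) + (blinfun_apply A b - y0)"
          by simp
        also have "norm \<dots> \<le> r / 8 + r / 8"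
          using a(2) b(2) by (intro norm_triangle_mono) (auto simp: dist_norm norm_minus_commute)
        finally have "s * norm (y - blinfun_apply A ?x) \<le> r / 4"
          using s by simp
        then show ?thesis
          using False r(1) by (simp add: s_def field_simps)
      qed
      ultimately show ?thesis by (intro exI[of _ ?x]) simp
    qed
  qed
qed

text \<open>Successive correction: each step halves the residual \<open>u k\<close>, so the
  corrections \<open>g (u k)\<close> are dominated by a geometric series of sum 2 M times the norm
  of y, and completeness of the domain gives the exact preimage.\<close>

lemma open_mapping_bound:
  fixes A :: "'a::banach \<Rightarrow>\<^sub>L 'b::banach"
  assumes "closed (range (blinfun_apply A))"
  obtains c where "0 \<le> c"
    "\<And>x. \<exists>z. blinfun_apply A z = blinfun_apply A x \<and> norm z \<le> c * norm (blinfun_apply A x)"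
proof -
  obtain M where M: "0 \<le> M"
    "\<And>y. y \<in> range (blinfun_apply A) \<Longrightarrow> \<exists>x. norm x \<le> M * norm y \<and> norm (y - blinfun_apply A x) \<le> norm y / 2"
    using open_mapping_approximation[OF assms] by blast
  then obtain g where g: "\<And>y. y \<in> range (blinfun_apply A) \<Longrightarrow> norm (g y) \<le> M * norm y"
    "\<And>y. y \<in> range (blinfun_apply A) \<Longrightarrow> norm (y - blinfun_apply A (g y)) \<le> norm y / 2"
    by metis
  show thesis
  proof
    show "0 \<le> 2 * M" using M by simp
    fix x
    define y where "y = blinfun_apply A x"
    define h where "h = (\<lambda>u. u - blinfun_apply A (g u))"
    define u where "u k = (h ^^ k) y" for k
    have u_Suc: "u (Suc k) = u k - blinfun_apply A (g (u k))" for k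
      by (simp add: u_def h_def)
    have u_range: "u k \<in> range (blinfun_apply A)" for k
    proof (induction k)
      case 0
      then show ?case by (simp add: u_def y_def)
    next
      case (Suc k)
      then obtain v where "u k = blinfun_apply A v" by blast
      then have "u (Suc k) = blinfun_apply A (v - g (u k))"
        by (simp add: u_Suc blinfun.diff_right)
      then show ?case by blast
    qed
    have u_norm: "norm (u k) \<le> norm y * (1 / 2) ^ k" for k
    proof (induction k)
      case 0
      then show ?case by (simp add: u_def)
    next
      case (Suc k)
      then show ?case
        using g(2)[OF u_range[of k]] by (simp add: u_Suc)
    qed
    have gu: "norm (g (u k)) \<le> M * norm y * (1 / 2) ^ k" for k
      using g(1)[OF u_range[of k]] mult_left_mono[OF u_norm[of k] M(1)] by simp
    have geo: "(\<lambda>k. M * norm y * (1 / 2) ^ k) sums (M * norm y * 2)"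
      using sums_mult[OF geometric_sums[of "1 / 2 :: real"], of "M * norm y"] by simp
    have summ: "summable (\<lambda>k. norm (g (u k)))"
      using gu by (intro summable_comparison_test'[OF sums_summable[OF geo], of 0]) auto
    define z where "z = (\<Sum>k. g (u k))"
    have "(\<lambda>k. g (u k)) sums z"
      unfolding z_def using summable_norm_cancel[OF summ] by (rule summable_sums)
    then have "(\<lambda>k. blinfun_apply A (g (u k))) sums blinfun_apply A z"
      by (rule bounded_linear.sums[OF blinfun.bounded_linear_right])
    moreover have "(\<lambda>k. blinfun_apply A (g (u k))) sums y"
    proof -
      have "(\<Sum>k<n. blinfun_apply A (g (u k))) = y - u n" for n
        by (induction n) (auto simp: u_Suc, simp add: u_def)
      moreover have "u \<longlonglongrightarrow> 0"
      proof (rule tendsto_norm_zero_cancel, rule tendsto_sandwich[OF _ _ tendsto_const])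
        show "\<forall>\<^sub>F k in sequentially. norm (u k) \<le> norm y * (1 / 2) ^ k"
          using u_norm by auto
        show "(\<lambda>k. norm y * (1 / 2) ^ k) \<longlonglongrightarrow> 0"
          by (intro tendsto_mult_right_zero LIMSEQ_power_zero) auto
      qed auto
      ultimately show ?thesis
        unfolding sums_def by (auto intro!: tendsto_eq_intros)
    qed
    ultimately have "blinfun_apply A z = y"
      by (metis sums_unique2)
    moreover have "norm z \<le> 2 * M * norm y"
    proof -
      have "norm z \<le> (\<Sum>k. norm (g (u k)))"
        unfolding z_def by (rule summable_norm[OF summ])
      also have "\<dots> \<le> (\<Sum>k. M * norm y * (1 / 2) ^ k)"
        using gu summ sums_summable[OF geo] by (intro suminf_le) auto
      also have "\<dots> = M * norm y * 2"
        using geo by (rule sums_unique[symmetric])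
      finally show ?thesis by (simp add: algebra_simps)
    qed
    ultimately show "\<exists>z. blinfun_apply A z = blinfun_apply A x \<and> norm z \<le> 2 * M * norm (blinfun_apply A x)"
      unfolding y_def by blast
  qed
qed

section \<open>Subspaces of finite codimension\<close>

text \<open>A functional that is 1 at b and 0 on \<open>W\<close> reads off the coefficient of b
  continuously, so the span is the preimage of \<open>W\<close> under a continuous map.\<close>

lemma closed_span_insert:
  fixes W :: "'a::real_normed_vector set"
  assumes W: "subspace W" "closed W"
  shows "closed (span (insert b W))"
proof (cases "b \<in> W")
  case True
  then show ?thesis
    using W by (simp add: insert_absorb span_eq_iff[THEN iffD2])
next
  case False
  obtain \<phi> :: "'a \<Rightarrow>\<^sub>L real" where \<phi>: "blinfun_apply \<phi> b = 1" "\<And>w. w \<in> W \<Longrightarrow> blinfun_apply \<phi> w = 0"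
    using separating_functional[OF W False] by blast
  have "span (insert b W) = {y. y - blinfun_apply \<phi> y *\<^sub>R b \<in> W}"
  proof (intro set_eqI iffI)
    fix y assume "y \<in> span (insert b W)"
    then obtain t where t: "y - t *\<^sub>R b \<in> W"
      using W(1) by (auto simp: span_breakdown_eq span_eq_iff[THEN iffD2])
    then have "blinfun_apply \<phi> y = t"
      using \<phi>(2)[OF t] \<phi>(1) by (simp add: blinfun.diff_right blinfun.scaleR_right)
    then show "y \<in> {y. y - blinfun_apply \<phi> y *\<^sub>R b \<in> W}"
      using t by simp
  next
    fix y assume "y \<in> {y. y - blinfun_apply \<phi> y *\<^sub>R b \<in> W}"
    then show "y \<in> span (insert b W)"
      using W(1) by (auto simp: span_breakdown_eq span_eq_iff[THEN iffD2])
  qed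
  moreover have "closed ((\<lambda>y. y - blinfun_apply \<phi> y *\<^sub>R b) -` W)"
    using W(2) by (rule continuous_closed_vimage) (intro continuous_intros)
  ultimately show ?thesis by (simp add: vimage_def)
qed

lemma closed_span_Un_finite:
  fixes W :: "'a::real_normed_vector set"
  assumes "finite B" and W: "subspace W" "closed W"
  shows "closed (span (W \<union> B))"
  using \<open>finite B\<close>
proof induction
  case empty
  then show ?case using W by (simp add: span_eq_iff[THEN iffD2])
next
  case (insert b B)
  have "span (insert b (span (W \<union> B))) = span (insert b (W \<union> B))"
    by (intro antisym span_minimal span_mono insert_subsetI)
      (auto intro: span_base span_mono[THEN subsetD, rotated])
  then show ?case
    using closed_span_insert[OF subspace_span insert.IH, of b] by (metis Un_insert_right)
qed

lemma closed_span_finite: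
  fixes B :: "'a::real_normed_vector set"
  assumes "finite B"
  shows "closed (span B)"
proof -
  have "span ({0} \<union> B) = span B"
    by (simp add: span_insert_0)
  then show ?thesis
    using closed_span_Un_finite[OF assms, of "{0}"] by (simp add: subspace_single_0)
qed

text \<open>A bounded operator on the whole space that acts on the sum of \<open>W\<close> and
  \<open>span B\<close> as the projection onto \<open>W\<close> along \<open>span B\<close>. Its
  values elsewhere are left open, so \<open>B\<close> may be independent without generating.\<close>

lemma projection_along_mod_indep:
  fixes W :: "'a::real_normed_vector set"
  assumes "subspace W" "closed W" "mod_indep W B"
  obtains Q :: "'a \<Rightarrow>\<^sub>L 'a" where "\<And>w. w \<in> W \<Longrightarrow> blinfun_apply Q w = w" "\<And>v. v \<in> span B \<Longrightarrow> blinfun_apply Q v = 0"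
proof -
  have "finite B"
    using assms by (simp add: mod_indep_def)
  then have "\<exists>Q :: 'a \<Rightarrow>\<^sub>L 'a. (\<forall>w\<in>W. blinfun_apply Q w = w) \<and> (\<forall>v\<in>B. blinfun_apply Q v = 0)"
    using assms
  proof (induction arbitrary: W)
    case empty
    then show ?case by (intro exI[of _ id_blinfun]) auto
  next
    case (insert b B)
    have "mod_indep W B"
      using insert.prems(3) by (rule mod_indep_mono) auto
    have bW: "b \<notin> W"
    proof
      assume "b \<in> W"
      moreover have "b \<in> span (insert b B)"
        by (simp add: span_base)
      ultimately have "b = 0"
        using span_meets_trivially[OF insert.prems(3)] by blast
      then show False
        using mod_indep_independent[OF insert.prems(1,3)] dependent_zero[of "insert b B"] by auto
    qed
    let ?W = "span (insert b W)"
    have "mod_indep ?W B"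
    proof (rule mod_indepI)
      fix c v assume *: "(\<Sum>v\<in>B. c v *\<^sub>R v) \<in> ?W" "v \<in> B"
      then obtain t where t: "(\<Sum>v\<in>B. c v *\<^sub>R v) - t *\<^sub>R b \<in> W"
        using insert.prems(1) by (auto simp: span_breakdown_eq span_eq_iff[THEN iffD2])
      let ?d = "\<lambda>v. if v = b then - t else c v"
      have "(\<Sum>v\<in>insert b B. ?d v *\<^sub>R v) = (\<Sum>v\<in>B. c v *\<^sub>R v) - t *\<^sub>R b"
      proof -
        have "(\<Sum>v\<in>B. ?d v *\<^sub>R v) = (\<Sum>v\<in>B. c v *\<^sub>R v)"
          using insert.hyps by (intro sum.cong) auto
        then show ?thesis
          using insert.hyps by simp
      qed
      then have "?d v = 0"
        using mod_indepD[OF insert.prems(3), of ?d v] t *(2) by simp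
      then show "c v = 0"
        using *(2) insert.hyps(2) by (metis)
    qed (fact insert.hyps)
    then obtain Q :: "'a \<Rightarrow>\<^sub>L 'a" where Q: "\<forall>w\<in>?W. blinfun_apply Q w = w" "\<forall>v\<in>B. blinfun_apply Q v = 0"
      using insert.IH[of ?W] closed_span_insert[OF insert.prems(1,2)] by auto
    obtain \<phi> :: "'a \<Rightarrow>\<^sub>L real" where \<phi>: "blinfun_apply \<phi> b = 1" "\<And>w. w \<in> W \<Longrightarrow> blinfun_apply \<phi> w = 0"
      using separating_functional[OF insert.prems(1,2) bW] by blast
    \<comment> \<open>The operator for the enlarged subspace keeps b; subtracting the b-coordinate
      sends b to 0 and leaves \<open>W\<close> unchanged.\<close>
    let ?f = "\<lambda>x. blinfun_apply Q x - blinfun_apply \<phi> (blinfun_apply Q x) *\<^sub>R b"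
    have "bounded_linear ?f"
      by (intro bounded_linear_sub bounded_linear_compose[OF bounded_linear_scaleR_left]
          bounded_linear_compose[OF blinfun.bounded_linear_right] blinfun.bounded_linear_right)
    then have app: "blinfun_apply (Blinfun ?f) = ?f"
      by (rule bounded_linear_Blinfun_apply)
    have inW: "w \<in> ?W" if "w \<in> insert b W" for w
      using that by (rule span_base)
    show ?case
      by (intro exI[of _ "Blinfun ?f"]) (use Q \<phi> inW in \<open>auto simp: app blinfun.zero_right\<close>)
  qed
  then obtain Q :: "'a \<Rightarrow>\<^sub>L 'a" where Q: "\<And>w. w \<in> W \<Longrightarrow> blinfun_apply Q w = w" "\<And>v. v \<in> B \<Longrightarrow> blinfun_apply Q v = 0"
    by blast
  have "blinfun_apply Q v = 0" if "v \<in> span B" for v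
    using linear_eq_0_on_span[OF bounded_linear.linear[OF blinfun.bounded_linear_right] Q(2) that] .
  then show thesis
    using that Q(1) by blast
qed

text \<open>A functional vanishing on \<open>W\<close> cannot distinguish y from y - w, so its norm
  is at most half of itself and it is 0.\<close>

lemma closed_subspace_eq_UNIV:
  fixes W :: "'a::real_normed_vector set"
  assumes "subspace W" "closed W" and near: "\<And>y. \<exists>w\<in>W. norm (y - w) \<le> norm y / 2"
  shows "W = UNIV"
proof (rule ccontr)
  assume "W \<noteq> UNIV"
  then obtain b where "b \<notin> W" by blast
  then obtain \<phi> :: "'a \<Rightarrow>\<^sub>L real" where \<phi>: "blinfun_apply \<phi> b = 1" "\<And>w. w \<in> W \<Longrightarrow> blinfun_apply \<phi> w = 0"
    using separating_functional assms(1,2) by blast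
  have "norm \<phi> \<le> norm \<phi> / 2"
  proof (rule norm_blinfun_bound)
    fix y
    obtain w where w: "w \<in> W" "norm (y - w) \<le> norm y / 2"
      using near by blast
    have "norm (blinfun_apply \<phi> y) = norm (blinfun_apply \<phi> (y - w))"
      using \<phi>(2)[OF w(1)] by (simp add: blinfun.diff_right)
    also have "\<dots> \<le> norm \<phi> * norm (y - w)"
      by (rule norm_blinfun)
    also have "\<dots> \<le> norm \<phi> * (norm y / 2)"
      using w(2) by (intro mult_left_mono) auto
    finally show "norm (blinfun_apply \<phi> y) \<le> norm \<phi> / 2 * norm y"
      by simp
  qed simp
  then have "\<phi> = 0"
    by (smt (verit) field_sum_of_halves norm_ge_zero norm_le_zero_iff)
  then show False
    using \<phi>(1) by simp
qed

section \<open>Images of closed subspaces under operators bounded below, and stability of their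
  codimension\<close>

lemma closed_image_bounded_below:
  fixes T :: "'a::banach \<Rightarrow>\<^sub>L 'b::banach"
  assumes "subspace E" "closed E" "0 < c" and "\<And>x. x \<in> E \<Longrightarrow> c * norm x \<le> norm (blinfun_apply T x)"
  shows "closed (blinfun_apply T ` E)"
  using complete_isometric_image[OF \<open>0 < c\<close> \<open>subspace E\<close> blinfun.bounded_linear_right, of T] assms
  by (auto simp: complete_eq_closed)

lemma linear_blinfun_apply: "linear (blinfun_apply T)"
  by (rule bounded_linear.linear[OF blinfun.bounded_linear_right])

lemma subspace_blinfun_image: "subspace E \<Longrightarrow> subspace (blinfun_apply T ` E)"
  by (rule linear_subspace_image[OF linear_blinfun_apply])

lemma mod_span_iff_span: "subspace W \<Longrightarrow> mod_span W B \<longleftrightarrow> finite B \<and> span (W \<union> B) = UNIV"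
proof -
  assume W: "subspace W"
  have "(\<exists>v\<in>span B. y - v \<in> W) \<longleftrightarrow> y \<in> span (W \<union> B)" for y
  proof
    assume "\<exists>v\<in>span B. y - v \<in> W"
    then obtain v where "v \<in> span B" "y - v \<in> W" by blast
    then have "(y - v) + v \<in> span (W \<union> B)"
      by (meson Un_upper2 UnI1 in_mono span_add span_base span_mono)
    then show "y \<in> span (W \<union> B)" by simp
  next
    assume "y \<in> span (W \<union> B)"
    then obtain w v where "y = w + v" "w \<in> W" "v \<in> span B"
      using W by (auto simp: span_Un span_eq_iff[THEN iffD2])
    then show "\<exists>v\<in>span B. y - v \<in> W"
      by (intro bexI[of _ v]) auto
  qed
  then show ?thesis
    unfolding mod_span_def by blast
qed

lemma mod_basis_stable:
  fixes T :: "'a::banach \<Rightarrow>\<^sub>L 'b::banach"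
  assumes E: "subspace E" "closed E" and c: "0 < c"
    and below: "\<And>x. x \<in> E \<Longrightarrow> c * norm x \<le> norm (blinfun_apply T x)"
    and V: "mod_indep (blinfun_apply T ` E) V"
  obtains \<delta> where "0 < \<delta>"
    "\<And>S. norm (S - T) < \<delta> \<Longrightarrow> mod_indep (blinfun_apply S ` E) V"
    "\<And>S. norm (S - T) < \<delta> \<Longrightarrow> mod_span (blinfun_apply T ` E) V \<Longrightarrow> mod_span (blinfun_apply S ` E) V"
proof -
  have TE: "subspace (blinfun_apply T ` E)" "closed (blinfun_apply T ` E)"
    using E subspace_blinfun_image closed_image_bounded_below[OF E c below] by auto
  obtain Q :: "'b \<Rightarrow>\<^sub>L 'b" where Q: "\<And>w. w \<in> blinfun_apply T ` E \<Longrightarrow> blinfun_apply Q w = w"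
    "\<And>v. v \<in> span V \<Longrightarrow> blinfun_apply Q v = 0"
    using projection_along_mod_indep[OF TE V] by blast
  \<comment> \<open>The summand 1 permits division by q even if Q is 0; \<delta> is then chosen so
    that Q (S - T) costs at most c / 2.\<close>
  define q where "q = norm Q + 1"
  have q: "q \<ge> 1" "norm Q \<le> q"
    by (auto simp: q_def)
  have Qle: "norm (blinfun_apply Q y) \<le> q * norm y" for y
    using norm_blinfun[of Q y] mult_right_mono[OF q(2) norm_ge_zero[of y]] by linarith
  define \<delta> where "\<delta> = c / (2 * q)"
  have \<delta>: "0 < \<delta>" "q * \<delta> = c / 2"
    using c q by (auto simp: \<delta>_def)
  have key: "c / 2 * norm x \<le> q * norm (blinfun_apply S x + v)"
    if S: "norm (S - T) < \<delta>" and x: "x \<in> E" and v: "v \<in> span V" for S x v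
  proof -
    have "norm (blinfun_apply (S - T) x) \<le> \<delta> * norm x"
      using norm_blinfun[of "S - T" x] mult_right_mono[of "norm (S - T)" \<delta> "norm x"] S by simp
    then have "norm (blinfun_apply Q (blinfun_apply (S - T) x)) \<le> q * (\<delta> * norm x)"
      using Qle[of "blinfun_apply (S - T) x"] q by (smt (verit) mult_left_mono)
    also have "\<dots> = c / 2 * norm x"
      using \<delta>(2) by (metis mult.assoc)
    finally have 1: "norm (blinfun_apply Q (blinfun_apply (S - T) x)) \<le> c / 2 * norm x" .
    have "blinfun_apply Q (blinfun_apply S x + v) = blinfun_apply T x + blinfun_apply Q (blinfun_apply (S - T) x)"
      using Q(1)[of "blinfun_apply T x"] Q(2)[OF v] x
      by (simp add: blinfun.add_right blinfun.diff_left blinfun.diff_right)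
    then have "norm (blinfun_apply T x) - c / 2 * norm x \<le> norm (blinfun_apply Q (blinfun_apply S x + v))"
      using 1 norm_triangle_ineq4[of "blinfun_apply T x + blinfun_apply Q (blinfun_apply (S - T) x)" "blinfun_apply Q (blinfun_apply (S - T) x)"]
      by simp
    then show ?thesis
      using below[OF x] Qle[of "blinfun_apply S x + v"] by simp
  qed
  show thesis
  proof
    show "0 < \<delta>" by (rule \<delta>(1))
    fix S assume S: "norm (S - T) < \<delta>"
    show "mod_indep (blinfun_apply S ` E) V"
    proof (rule mod_indepI)
      show "finite V"
        using V by (simp add: mod_indep_def)
      fix a b assume *: "(\<Sum>b\<in>V. a b *\<^sub>R b) \<in> blinfun_apply S ` E" "b \<in> V"
      then obtain x where x: "x \<in> E" "(\<Sum>b\<in>V. a b *\<^sub>R b) = blinfun_apply S x" by blast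
      have "- (\<Sum>b\<in>V. a b *\<^sub>R b) \<in> span V"
        by (intro span_neg span_sum span_scale span_base)
      from key[OF S x(1) this] have "x = 0"
        using x(2) c by (simp add: mult_le_0_iff)
      then have "(\<Sum>b\<in>V. a b *\<^sub>R b) \<in> blinfun_apply T ` E"
        using x TE(1) by (simp add: blinfun.zero_right subspace_0)
      then show "a b = 0"
        using mod_indepD[OF V] *(2) by blast
    qed
    assume span: "mod_span (blinfun_apply T ` E) V"
    have finV: "finite V"
      using span by (simp add: mod_span_def)
    have SE: "subspace (blinfun_apply S ` E)"
      using E(1) by (rule subspace_blinfun_image)
    have "closed (blinfun_apply S ` E)"
    proof (rule closed_image_bounded_below[OF E])
      show "0 < c / (2 * q)"
        using c q by simp
      show "c / (2 * q) * norm x \<le> norm (blinfun_apply S x)" if "x \<in> E" for x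
        using key[OF S that span_zero] q by (simp add: field_simps)
    qed
    then have clo: "closed (span (blinfun_apply S ` E \<union> V))"
      by (rule closed_span_Un_finite[OF finV SE])
    have "span (blinfun_apply S ` E \<union> V) = UNIV"
    proof (rule closed_subspace_eq_UNIV[OF subspace_span clo])
      fix y
      obtain v x where vx: "v \<in> span V" "x \<in> E" "y - v = blinfun_apply T x"
        using span unfolding mod_span_def by blast
      \<comment> \<open>Applying Q to the decomposition of y bounds x by q / c times the norm of y.
        Replacing T x by S x therefore costs at most \<delta> q / c = 1/2 of that norm.\<close>
      have "blinfun_apply Q y = blinfun_apply T x"
        using Q(1)[of "blinfun_apply T x"] Q(2)[OF vx(1)] vx(2,3)
        by (metis blinfun.diff_right diff_zero imageI)
      then have "c * norm x \<le> q * norm y"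
        using below[OF vx(2)] Qle[of y] by simp
      let ?w = "blinfun_apply S x + v"
      have "?w \<in> span (blinfun_apply S ` E \<union> V)"
        using vx by (meson Un_upper2 UnI1 imageI in_mono span_add span_base span_mono)
      moreover have "norm (y - ?w) \<le> norm y / 2"
      proof -
        have "y - ?w = blinfun_apply (T - S) x"
          using vx(3) by (simp add: blinfun.diff_left algebra_simps)
        then have "norm (y - ?w) \<le> norm (S - T) * norm x"
          using norm_blinfun[of "T - S" x] by (simp add: norm_minus_commute)
        also have "\<dots> \<le> \<delta> * norm x"
          using S by (intro mult_right_mono) auto
        also have "\<dots> \<le> norm y / 2"
          using \<open>c * norm x \<le> q * norm y\<close> q c by (simp add: \<delta>_def field_simps)
        finally show ?thesis .
      qed
      ultimately show "\<exists>w\<in>span (blinfun_apply S ` E \<union> V). norm (y - w) \<le> norm y / 2" by blast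
    qed
    then show "mod_span (blinfun_apply S ` E) V"
      using mod_span_iff_span[OF SE] finV by blast
  qed
qed

text \<open>The codimension of \<open>(T + t S) E\<close> is locally constant in \<open>t\<close>, also where it is infinite.\<close>

lemma quotient_basis_homotopy:
  fixes T S :: "'a::banach \<Rightarrow>\<^sub>L 'b::banach"
  assumes E: "subspace E" "closed E" and c: "0 < c"
    and below: "\<And>t x. 0 \<le> t \<Longrightarrow> t \<le> 1 \<Longrightarrow> x \<in> E \<Longrightarrow> c * norm x \<le> norm (blinfun_apply (T + t *\<^sub>R S) x)"
    and V: "quotient_basis (blinfun_apply T ` E) V"
  obtains V' where "quotient_basis (blinfun_apply (T + S) ` E) V'" "card V' = card V"
proof -
  define H where "H t = blinfun_apply (T + t *\<^sub>R S) ` E" for t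
  define P where "P t \<longleftrightarrow> (\<exists>B. quotient_basis (H t) B \<and> card B = card V)" for t
  have sub: "subspace (H t)" for t
    unfolding H_def using E(1) by (rule subspace_blinfun_image)
  have nbhd: "\<exists>U. openin (top_of_set {0..1}) U \<and> a \<in> U \<and>
      (\<forall>t\<in>U. mod_indep (H t) C \<and> (mod_span (H a) C \<longrightarrow> mod_span (H t) C))"
    if a: "a \<in> {0..1}" and C: "mod_indep (H a) C" for a C
  proof -
    obtain \<delta> where \<delta>: "0 < \<delta>"
      "\<And>R. norm (R - (T + a *\<^sub>R S)) < \<delta> \<Longrightarrow> mod_indep (blinfun_apply R ` E) C"
      "\<And>R. norm (R - (T + a *\<^sub>R S)) < \<delta> \<Longrightarrow> mod_span (H a) C \<Longrightarrow> mod_span (blinfun_apply R ` E) C"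
      using mod_basis_stable[OF E c below C[unfolded H_def]] a unfolding H_def by auto
    let ?U = "{0..1} \<inter> {t. norm (T + t *\<^sub>R S - (T + a *\<^sub>R S)) < \<delta>}"
    have "open {t. norm (T + t *\<^sub>R S - (T + a *\<^sub>R S)) < \<delta>}"
      by (intro open_Collect_less continuous_intros)
    then have "openin (top_of_set {0..1}) ?U"
      by (rule openin_open_Int)
    moreover have "a \<in> ?U"
      using a \<delta>(1) by simp
    moreover have "\<forall>t\<in>?U. mod_indep (H t) C \<and> (mod_span (H a) C \<longrightarrow> mod_span (H t) C)"
      using \<delta>(2,3) unfolding H_def by blast
    ultimately show ?thesis by blast
  qed
  have "P 1"
  proof (rule connected_induction_simple[of "{0..1::real}" 0])
    show "P 0"
      using V by (auto simp: P_def H_def)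
    fix a :: real assume a: "a \<in> {0..1}"
    show "\<exists>U. openin (top_of_set {0..1}) U \<and> a \<in> U \<and> (\<forall>x\<in>U. \<forall>y\<in>U. P x \<longrightarrow> P y)"
    proof (rule quotient_basis_or_large_indep[OF sub[of a], where k = "Suc (card V)"])
      fix D assume D: "quotient_basis (H a) D"
      then obtain U where U: "openin (top_of_set {0..1}) U" "a \<in> U" "\<forall>t\<in>U. quotient_basis (H t) D"
        using nbhd[OF a, of D] unfolding quotient_basis_iff by blast
      \<comment> \<open>One basis serves the whole neighbourhood, so the truth value of P is
        constant there.\<close>
      have "\<forall>x\<in>U. P x \<longleftrightarrow> card D = card V"
        using U(3) quotient_basis_card_eq[OF sub] unfolding P_def by metis
      then show ?thesis
        using U(1,2) by blast
    next
      \<comment> \<open>This case includes infinite codimension at a. One vector more than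
        \<open>card V\<close> suffices: the set stays independent nearby, so P fails on all of
        U.\<close>
      fix C assume C: "mod_indep (H a) C" "card C = Suc (card V)"
      then obtain U where U: "openin (top_of_set {0..1}) U" "a \<in> U" "\<forall>t\<in>U. mod_indep (H t) C"
        using nbhd[OF a, of C] by blast
      have "\<not> P x" if x: "x \<in> U" for x
      proof
        assume "P x"
        then obtain B where "mod_span (H x) B" "card B = card V"
          by (auto simp: P_def quotient_basis_iff)
        then show False
          using mod_indep_card_le[OF sub, of x C B] U(3) x C(2) by auto
      qed
      then show ?thesis
        using U(1,2) by blast
    qed
  qed auto
  then show thesis
    using that by (auto simp: P_def H_def)
qed

section \<open>Common kernels of finitely many functionals\<close>

definition annihilated :: "('a::real_normed_vector \<Rightarrow>\<^sub>L real) set \<Rightarrow> 'a set" where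
  "annihilated \<Phi> = {x. \<forall>\<phi>\<in>\<Phi>. blinfun_apply \<phi> x = 0}"

lemma annihilated_Un: "annihilated (\<Phi> \<union> \<Psi>) = annihilated \<Phi> \<inter> annihilated \<Psi>"
  by (auto simp: annihilated_def)

lemma subspace_annihilated: "subspace (annihilated \<Phi>)"
  by (auto simp: annihilated_def subspace_def blinfun.add_right blinfun.scaleR_right blinfun.zero_right)

lemma closed_annihilated: "closed (annihilated \<Phi>)"
proof -
  have "annihilated \<Phi> = (\<Inter>\<phi>\<in>\<Phi>. {x. blinfun_apply \<phi> x = 0})"
    by (auto simp: annihilated_def)
  moreover have "closed {x. blinfun_apply \<phi> x = 0}" for \<phi> :: "'a \<Rightarrow>\<^sub>L real"
    by (intro closed_Collect_eq continuous_intros)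
  ultimately show ?thesis by auto
qed

text \<open>Each functional raises the codimension by at most one: either it already vanishes on the
  previous common kernel, or one vector u of that kernel corrects its value.\<close>

lemma annihilated_mod_span:
  fixes \<Phi> :: "('a::real_normed_vector \<Rightarrow>\<^sub>L real) set"
  assumes "finite \<Phi>"
  shows "\<exists>B. mod_span (annihilated \<Phi>) B \<and> card B \<le> card \<Phi>"
  using assms
proof induction
  case empty
  have "mod_span (annihilated ({} :: ('a \<Rightarrow>\<^sub>L real) set)) {}"
    by (simp add: mod_span_def annihilated_def)
  then show ?case by (intro exI[of _ "{}"]) simp
next
  case (insert \<phi> \<Phi>)
  then obtain B where B: "mod_span (annihilated \<Phi>) B" "card B \<le> card \<Phi>" by blast
  show ?case
  proof (cases "\<exists>u\<in>annihilated \<Phi>. blinfun_apply \<phi> u \<noteq> 0")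
    case False
    then have "annihilated (insert \<phi> \<Phi>) = annihilated \<Phi>"
      by (auto simp: annihilated_def)
    then show ?thesis
      using B insert.hyps by (intro exI[of _ B]) auto
  next
    case True
    then obtain u where u: "u \<in> annihilated \<Phi>" "blinfun_apply \<phi> u \<noteq> 0" by blast
    have "\<exists>v\<in>span (insert u B). y - v \<in> annihilated (insert \<phi> \<Phi>)" for y
    proof -
      obtain v where v: "v \<in> span B" "y - v \<in> annihilated \<Phi>"
        using B(1) by (auto simp: mod_span_def)
      define t where "t = blinfun_apply \<phi> (y - v) / blinfun_apply \<phi> u"
      have "v + t *\<^sub>R u \<in> span (insert u B)"
        using v(1) by (meson in_mono insertI1 span_add span_base span_mono span_scale subset_insertI)
      moreover have "y - (v + t *\<^sub>R u) \<in> annihilated \<Phi>"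
        using subspace_diff[OF subspace_annihilated v(2) subspace_scale[OF subspace_annihilated u(1)], of t]
        by (simp add: algebra_simps)
      moreover have "blinfun_apply \<phi> (y - (v + t *\<^sub>R u)) = 0"
        using u(2) by (simp add: t_def blinfun.diff_right blinfun.add_right blinfun.scaleR_right)
      ultimately show ?thesis
        by (intro bexI[of _ "v + t *\<^sub>R u"]) (auto simp: annihilated_def)
    qed
    then have "mod_span (annihilated (insert \<phi> \<Phi>)) (insert u B)"
      using B(1) by (simp add: mod_span_def)
    moreover have "card (insert u B) \<le> card (insert \<phi> \<Phi>)"
      using B insert.hyps card_insert_le_m1[of "card (insert \<phi> \<Phi>)" B u] by simp
    ultimately show ?thesis by blast
  qed
qed

lemma annihilated_quotient_basis:
  fixes \<Phi> :: "('a::real_normed_vector \<Rightarrow>\<^sub>L real) set"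
  assumes "finite \<Phi>"
  obtains U where "quotient_basis (annihilated \<Phi>) U" "card U \<le> card \<Phi>"
proof -
  obtain B where B: "mod_span (annihilated \<Phi>) B" "card B \<le> card \<Phi>"
    using annihilated_mod_span[OF assms] by blast
  obtain U where U: "quotient_basis (annihilated \<Phi>) U"
    using mod_indep_extend[OF subspace_annihilated mod_indep_empty B(1)] by blast
  then show thesis
    using that mod_indep_card_le[OF subspace_annihilated _ B(1)] B(2) by (meson order_trans quotient_basis_iff)
qed

text \<open>The functionals act as coordinates on \<open>span K\<close>. If they vanish on e + k,
  the coordinates of k are minus their values at e, so e controls k. In particular, e = 0 shows that
  the common kernel meets \<open>span K\<close> only in 0.\<close>

lemma finite_span_norm_bound:
  fixes K :: "'a::real_normed_vector set"
  assumes "finite K"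
  shows "\<exists>\<Phi> C. finite \<Phi> \<and> 0 \<le> C \<and>
    (\<forall>k\<in>span K. \<forall>e. e + k \<in> annihilated \<Phi> \<longrightarrow> norm k \<le> C * norm e)"
  using assms
proof induction
  case empty
  then show ?case by (intro exI[of _ "{}"] exI[of _ 0]) auto
next
  case (insert b K)
  then obtain \<Phi> C where *: "finite \<Phi>" "0 \<le> C"
    "\<And>k e. k \<in> span K \<Longrightarrow> e + k \<in> annihilated \<Phi> \<Longrightarrow> norm k \<le> C * norm e"
    by blast
  show ?case
  proof (cases "b \<in> span K")
    case True
    then have "span (insert b K) = span K"
      by (simp add: span_redundant)
    then show ?thesis
      using * by (intro exI[of _ \<Phi>] exI[of _ C]) auto
  next
    case False
    obtain \<phi> :: "'a \<Rightarrow>\<^sub>L real" where \<phi>: "blinfun_apply \<phi> b = 1" "\<And>w. w \<in> span K \<Longrightarrow> blinfun_apply \<phi> w = 0"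
      using separating_functional[OF subspace_span closed_span_finite[OF insert.hyps(1)] False] by blast
    define N where "N = norm \<phi> * norm b"
    have N: "0 \<le> N"
      by (simp add: N_def)
    \<comment> \<open>The b-part of k is at most N times the norm of e. The rest is paired with e +
      t b, whose norm is at most 1 + N times that of e, which adds the factor C * (1 + N).\<close>
    have "norm k \<le> (C * (1 + N) + N) * norm e"
      if k: "k \<in> span (insert b K)" and ek: "e + k \<in> annihilated (insert \<phi> \<Phi>)" for k e
    proof -
      obtain t where t: "k - t *\<^sub>R b \<in> span K"
        using k by (auto simp: span_breakdown_eq)
      define k' where "k' = k - t *\<^sub>R b"
      have k': "k' \<in> span K" "k = k' + t *\<^sub>R b"
        using t by (auto simp: k'_def)
      have "blinfun_apply \<phi> (e + k) = 0"
        using ek by (simp add: annihilated_def)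
      then have "t = - blinfun_apply \<phi> e"
        using \<phi>(1) \<phi>(2)[OF k'(1)] by (simp add: k'(2) blinfun.add_right blinfun.scaleR_right)
      then have "norm (t *\<^sub>R b) \<le> norm \<phi> * norm e * norm b"
        using norm_blinfun[of \<phi> e] by (simp add: mult_right_mono)
      then have tb: "norm (t *\<^sub>R b) \<le> N * norm e"
        by (simp add: N_def mult_ac)
      have "e + t *\<^sub>R b + k' \<in> annihilated \<Phi>"
        using ek by (simp add: annihilated_def k'(2) add_ac)
      from *(3)[OF k'(1) this] have "norm k' \<le> C * norm (e + t *\<^sub>R b)" .
      also have "\<dots> \<le> C * (norm e + N * norm e)"
        using norm_triangle_ineq[of e "t *\<^sub>R b"] tb *(2) by (intro mult_left_mono) auto
      finally show ?thesis
        using norm_triangle_ineq[of k' "t *\<^sub>R b"] tb by (simp add: k'(2) algebra_simps)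
    qed
    then show ?thesis
      using *(1,2) N by (intro exI[of _ "insert \<phi> \<Phi>"] exI[of _ "C * (1 + N) + N"]) auto
  qed
qed

text \<open>Closed range gives a preimage z of A x controlled by A x. The difference x - z lies in
  the finite-dimensional kernel and, where the coordinate functionals vanish on x, is controlled by
  z.\<close>

lemma lower_semi_Fredholm_bounded_below:
  fixes A :: "'a::banach \<Rightarrow>\<^sub>L 'b::banach"
  assumes "lower_semi_Fredholm A"
  obtains \<Phi> c where "finite \<Phi>" "0 < c" "\<And>x. x \<in> annihilated \<Phi> \<Longrightarrow> c * norm x \<le> norm (blinfun_apply A x)"
proof -
  obtain M where M: "0 \<le> M"
    "\<And>x. \<exists>z. blinfun_apply A z = blinfun_apply A x \<and> norm z \<le> M * norm (blinfun_apply A x)"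
    using open_mapping_bound[of A] assms by (auto simp: lower_semi_Fredholm_def)
  obtain K where K: "finite K" "span K = {x. blinfun_apply A x = 0}"
    using edim_finite[of "{x. blinfun_apply A x = 0}"] assms
    by (auto simp: lower_semi_Fredholm_def nullity_def)
  obtain \<Phi> C where \<Phi>: "finite \<Phi>" "0 \<le> C"
    "\<And>k e. k \<in> span K \<Longrightarrow> e + k \<in> annihilated \<Phi> \<Longrightarrow> norm k \<le> C * norm e"
    using finite_span_norm_bound[OF K(1)] by blast
  \<comment> \<open>The summand 1 keeps the denominator positive when M is 0.\<close>
  define c where "c = 1 / ((1 + C) * M + 1)"
  have pos: "0 < (1 + C) * M + 1"
    using M(1) \<Phi>(2) by (simp add: add_nonneg_pos)
  show thesis
  proof
    show "0 < c"
      using pos by (simp add: c_def)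
    fix x assume x: "x \<in> annihilated \<Phi>"
    obtain z where z: "blinfun_apply A z = blinfun_apply A x" "norm z \<le> M * norm (blinfun_apply A x)"
      using M(2) by blast
    have "x - z \<in> span K"
      using z(1) by (simp add: K(2) blinfun.diff_right)
    then have "norm (x - z) \<le> C * norm z"
      using \<Phi>(3)[of "x - z" z] x by simp
    then have "norm x \<le> (1 + C) * norm z"
      using norm_triangle_ineq[of "x - z" z] by (simp add: algebra_simps)
    also have "\<dots> \<le> (1 + C) * (M * norm (blinfun_apply A x))"
      using z(2) \<Phi>(2) by (intro mult_left_mono) auto
    also have "\<dots> \<le> ((1 + C) * M + 1) * norm (blinfun_apply A x)"
      by (simp add: algebra_simps)
    finally show "c * norm x \<le> norm (blinfun_apply A x)"
      using pos by (simp add: c_def pos_divide_le_eq mult.commute)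
  qed (fact \<Phi>(1))
qed

section \<open>Perturbations with zero adjustment\<close>

text \<open>Elements of the graph of the null operator have second component 0, so in the second
  coordinate the adjustment compares A_n x_n with the fixed vector \<open>snd z\<close>
  alone.\<close>

lemma operator_adjustment_zero_cluster:
  fixes An :: "nat \<Rightarrow> 'a::banach \<Rightarrow>\<^sub>L 'b::banach"
  assumes adj: "operator_adjustment N An (\<lambda>n. 0) = 0" and "0 < \<eta>"
    and N2: "N2 \<subseteq> N" "infinite N2"
    and x: "\<And>n. n \<in> N2 \<Longrightarrow> max_norm (x n, blinfun_apply (An n) (x n)) = 1"
  obtains N3 w where "N3 \<subseteq> N2" "infinite N3" "\<And>n. n \<in> N3 \<Longrightarrow> norm (blinfun_apply (An n) (x n) - w) < \<eta>"
proof -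
  define L where "L = {l. lower_uniformly_adjusted max_norm l N (\<lambda>n. operator_graph (An n)) (\<lambda>n. operator_graph (0 :: 'a \<Rightarrow>\<^sub>L 'b))}"
  \<comment> \<open>The infimum 0 need not be attained: half of \<eta> pays for an admissible l, the
    other half for the tolerance in the definition.\<close>
  have "Inf (ereal ` L) < ereal (\<eta> / 2)"
    using adj \<open>0 < \<eta>\<close> unfolding operator_adjustment_def adjustment_def L_def by simp
  then obtain l where l: "l \<in> L" "l < \<eta> / 2"
    unfolding Inf_less_iff by auto
  let ?X = "\<lambda>n. (x n, blinfun_apply (An n) (x n))"
  have lua: "\<forall>\<eta>>0. \<forall>N2 x. N2 \<subseteq> N \<and> infinite N2 \<and> (\<forall>n\<in>N2. x n \<in> operator_graph (An n) \<and> max_norm (x n) = 1) \<longrightarrow>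
        (\<exists>N3 y z. N3 \<subseteq> N2 \<and> infinite N3 \<and> (\<forall>n\<in>N3. y n \<in> operator_graph (0 :: 'a \<Rightarrow>\<^sub>L 'b)) \<and>
           Limsup (inf sequentially (principal N3)) (\<lambda>n. ereal (max_norm (x n - y n - z)))
             \<le> ereal (l + \<eta>))"
    using l(1) unfolding L_def lower_uniformly_adjusted_def by blast
  have X: "N2 \<subseteq> N \<and> infinite N2 \<and> (\<forall>n\<in>N2. ?X n \<in> operator_graph (An n) \<and> max_norm (?X n) = 1)"
    using N2 x by (auto simp: operator_graph_def)
  obtain N3 y z where N3: "N3 \<subseteq> N2" "infinite N3" "\<forall>n\<in>N3. y n \<in> operator_graph (0 :: 'a \<Rightarrow>\<^sub>L 'b)"
    "Limsup (inf sequentially (principal N3)) (\<lambda>n. ereal (max_norm (?X n - y n - z))) \<le> ereal (l + \<eta> / 2)"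
    using lua[rule_format, of "\<eta> / 2" N2 ?X] X \<open>0 < \<eta>\<close> by auto
  have "Limsup (inf sequentially (principal N3)) (\<lambda>n. ereal (max_norm (?X n - y n - z))) < ereal \<eta>"
    using N3(4) l(2) by (auto elim!: le_less_trans)
  then have "\<forall>\<^sub>F n in inf sequentially (principal N3). max_norm (?X n - y n - z) < \<eta>"
    using Limsup_lessD by fastforce
  then obtain n1 where n1: "\<And>n. n1 \<le> n \<Longrightarrow> n \<in> N3 \<Longrightarrow> max_norm (?X n - y n - z) < \<eta>"
    unfolding eventually_inf_principal eventually_sequentially by blast
  show thesis
  proof
    show "N3 \<inter> {n1..} \<subseteq> N2"
      using N3(1) by blast
    have "N3 \<subseteq> (N3 \<inter> {n1..}) \<union> {..<n1}" by auto
    then show "infinite (N3 \<inter> {n1..})"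
      using N3(2) by (meson finite_UnI finite_lessThan finite_subset)
    fix n assume n: "n \<in> N3 \<inter> {n1..}"
    then have "snd (y n) = 0"
      using N3(3) by (auto simp: operator_graph_def)
    then show "norm (blinfun_apply (An n) (x n) - snd z) < \<eta>"
      using n1[of n] n by (simp add: max_norm_def)
  qed
qed

lemma operator_adjustment_zero_net:
  fixes An :: "nat \<Rightarrow> 'a::banach \<Rightarrow>\<^sub>L 'b::banach"
  assumes adj: "operator_adjustment N An (\<lambda>n. 0) = 0" and "0 < \<epsilon>"
  shows "\<exists>F n0. finite F \<and> (\<forall>n\<in>N. \<forall>x. n0 \<le> n \<longrightarrow> max_norm (x, blinfun_apply (An n) x) = 1 \<longrightarrow>
    (\<exists>f\<in>F. norm (blinfun_apply (An n) x - f) \<le> \<epsilon>))"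
proof (rule ccontr)
  assume neg: "\<not> ?thesis"
  then have step: "\<exists>n x. n \<in> N \<and> n0 \<le> n \<and> max_norm (x, blinfun_apply (An n) x) = 1 \<and>
      (\<forall>f\<in>F. \<epsilon> < norm (blinfun_apply (An n) x - f))" if "finite F" for F n0
    using neg that by (meson linorder_not_le)
  define P where "P = (\<lambda>(n, x, F). n \<in> N \<and> max_norm (x, blinfun_apply (An n) x) = 1 \<and>
    finite F \<and> blinfun_apply (An n) x \<in> F)"
  \<comment> \<open>A state carries a finite set containing all earlier images. This makes r
    transitive, so dependent choice yields separation for all pairs and not only for consecutive
    ones.\<close>
  define r where "r = {((n, x :: 'a, F), (n', x', F')). n < n' \<and> F \<subseteq> F' \<and>
    (\<forall>f\<in>F. \<epsilon> < norm (blinfun_apply (An n') x' - f))}"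
  have ext: "\<exists>n x. P (n, x, insert (blinfun_apply (An n) x) F) \<and> n0 < n \<and>
      (\<forall>f\<in>F. \<epsilon> < norm (blinfun_apply (An n) x - f))" if "finite F" for F n0
    using step[OF that, of "Suc n0"] that unfolding P_def Suc_le_eq by simp blast
  obtain s0 where s0: "P s0"
    using ext[of "{}" 0] by blast
  have tr: "trans r"
    unfolding r_def trans_def by auto
  have next_step: "\<exists>t. P t \<and> (s, t) \<in> r" if "P s" for s
  proof -
    obtain n x F where s: "s = (n, x, F)" by (cases s)
    have "finite F"
      using that by (simp add: P_def s)
    then obtain n' x' where n': "P (n', x', insert (blinfun_apply (An n') x') F)" "n < n'"
      "\<forall>f\<in>F. \<epsilon> < norm (blinfun_apply (An n') x' - f)"
      using ext[of F n] by blast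
    then have "(s, n', x', insert (blinfun_apply (An n') x') F) \<in> r"
      by (auto simp: r_def s)
    then show ?thesis
      using n'(1) by blast
  qed
  obtain g where g: "\<And>k :: nat. P (g k)" "\<And>i j. i < j \<Longrightarrow> (g i, g j) \<in> r"
    using dependent_choice[OF tr s0 next_step] by blast
  define n where "n k = fst (g k)" for k
  define x where "x k = fst (snd (g k))" for k
  have P: "n k \<in> N" "max_norm (x k, blinfun_apply (An (n k)) (x k)) = 1" for k
    using g(1)[of k] unfolding P_def n_def x_def by (auto simp: case_prod_beta)
  have far: "n i < n j \<and> \<epsilon> < norm (blinfun_apply (An (n j)) (x j) - blinfun_apply (An (n i)) (x i))" if "i < j" for i j
    using g(1)[of i] g(2)[OF that] unfolding P_def r_def n_def x_def by (auto simp: case_prod_beta)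
  have inj: "inj n"
    using far by (intro injI) (metis less_irrefl linorder_neqE_nat)
  \<comment> \<open>The chosen vectors are reindexed by their operator index through
    \<open>inv n\<close>. Two of them within \<epsilon>/2 of w contradict the separation.\<close>
  obtain N3 w where N3: "N3 \<subseteq> range n" "infinite N3"
    "\<And>m. m \<in> N3 \<Longrightarrow> norm (blinfun_apply (An m) (x (inv n m)) - w) < \<epsilon> / 2"
  proof (rule operator_adjustment_zero_cluster[OF adj, of "\<epsilon> / 2" "range n" "\<lambda>m. x (inv n m)"])
    show "infinite (range n)"
      using inj by (rule range_inj_infinite)
  qed (use P inj \<open>0 < \<epsilon>\<close> in auto)
  have "infinite (n -` N3)"
    using N3(1,2) by (metis finite_imageI image_vimage_eq inf.absorb1)
  then obtain i j where ij: "n i \<in> N3" "n j \<in> N3" "i < j"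
    unfolding infinite_nat_iff_unbounded by blast
  then have "norm (blinfun_apply (An (n i)) (x i) - w) < \<epsilon> / 2" "norm (blinfun_apply (An (n j)) (x j) - w) < \<epsilon> / 2"
    using N3(3)[OF ij(1)] N3(3)[OF ij(2)] inj by auto
  then have "norm (blinfun_apply (An (n j)) (x j) - blinfun_apply (An (n i)) (x i)) < \<epsilon>"
    by (metis dist_norm dist_triangle_half_l)
  then show False
    using far[OF ij(3)] by simp
qed

text \<open>The functionals are \<open>\<psi> f \<circ> An n\<close> with \<open>\<psi> f\<close> norming the point \<open>f\<close> of an \<open>\<epsilon>\<close>-net: where they
  vanish, the normalised \<open>An n x\<close> is near some \<open>f\<close> with \<open>norm f = \<psi> f (f - An n x)\<close> small.\<close>

lemma operator_adjustment_zero_small: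
  fixes An :: "nat \<Rightarrow> 'a::banach \<Rightarrow>\<^sub>L 'b::banach"
  assumes adj: "operator_adjustment N An (\<lambda>n. 0) = 0" and "0 < \<epsilon>"
  shows "\<exists>m n0. \<forall>n\<in>N. n0 \<le> n \<longrightarrow>
    (\<exists>\<Phi>. finite \<Phi> \<and> card \<Phi> \<le> m \<and> (\<forall>x\<in>annihilated \<Phi>. norm (blinfun_apply (An n) x) \<le> \<epsilon> * norm x))"
proof -
  \<comment> \<open>Two uses of d: 2 d \<le> \<epsilon> gives the final estimate, and 2 d < 1
    excludes that the maximum norm \<mu> is attained by the image.\<close>
  define d where "d = min \<epsilon> 1 / 4"
  have d: "0 < d" "2 * d < 1" "2 * d \<le> \<epsilon>"
    using \<open>0 < \<epsilon>\<close> by (auto simp: d_def min_def)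
  obtain F n0 where F: "finite F"
    "\<And>n x. n \<in> N \<Longrightarrow> n0 \<le> n \<Longrightarrow> max_norm (x, blinfun_apply (An n) x) = 1 \<Longrightarrow> \<exists>f\<in>F. norm (blinfun_apply (An n) x - f) \<le> d"
    using operator_adjustment_zero_net[OF adj d(1)] by blast
  have "\<exists>\<psi> :: 'b \<Rightarrow>\<^sub>L real. norm \<psi> \<le> 1 \<and> blinfun_apply \<psi> f = norm f" for f
    by (metis norming_functional)
  then obtain \<psi> :: "'b \<Rightarrow> 'b \<Rightarrow>\<^sub>L real" where \<psi>: "\<And>f. norm (\<psi> f) \<le> 1" "\<And>f. blinfun_apply (\<psi> f) f = norm f"
    by metis
  show ?thesis
  proof (rule exI[of _ "card F"], rule exI[of _ n0], intro ballI impI)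
    fix n assume n: "n \<in> N" "n0 \<le> n"
    let ?\<Phi> = "(\<lambda>f. \<psi> f o\<^sub>L An n) ` F"
    have "norm (blinfun_apply (An n) x) \<le> \<epsilon> * norm x" if x: "x \<in> annihilated ?\<Phi>" for x
    proof (cases "x = 0")
      case True
      then show ?thesis by (simp add: blinfun.zero_right)
    next
      case False
      define \<mu> where "\<mu> = max_norm (x, blinfun_apply (An n) x)"
      have \<mu>: "0 < \<mu>"
        using False by (simp add: \<mu>_def max_norm_def less_max_iff_disj)
      let ?x = "(1 / \<mu>) *\<^sub>R x"
      have "max_norm (?x, blinfun_apply (An n) ?x) = max_norm (x, blinfun_apply (An n) x) / \<mu>"
        using \<mu> by (simp add: max_norm_def blinfun.scaleR_right max_divide_distrib_right)
      then have "max_norm (?x, blinfun_apply (An n) ?x) = 1"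
        using \<mu> by (simp add: \<mu>_def)
      then obtain f where f: "f \<in> F" "norm (blinfun_apply (An n) ?x - f) \<le> d"
        using F(2) n by blast
      have "blinfun_apply (\<psi> f) (blinfun_apply (An n) ?x) = 0"
        using x f(1) by (simp add: annihilated_def blinfun.scaleR_right)
      then have "norm f = - blinfun_apply (\<psi> f) (blinfun_apply (An n) ?x - f)"
        using \<psi>(2) by (simp add: blinfun.diff_right)
      also have "\<dots> \<le> norm (\<psi> f) * norm (blinfun_apply (An n) ?x - f)"
        using norm_blinfun[of "\<psi> f" "blinfun_apply (An n) ?x - f"] by simp
      also have "\<dots> \<le> 1 * d"
        using \<psi>(1) f(2) by (intro mult_mono) auto
      finally have "norm (blinfun_apply (An n) ?x) \<le> 2 * d"
        using f(2) norm_triangle_ineq[of "blinfun_apply (An n) ?x - f" f] by simp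
      then have le: "norm (blinfun_apply (An n) x) \<le> 2 * d * \<mu>"
        using \<mu> by (simp add: blinfun.scaleR_right divide_le_eq)
      have "\<mu> = norm x"
      proof (rule ccontr)
        assume "\<mu> \<noteq> norm x"
        then have "norm (blinfun_apply (An n) x) = \<mu>"
          by (auto simp: \<mu>_def max_norm_def max_def split: if_splits)
        then show False
          using le d(2) \<mu> by simp
      qed
      then show ?thesis
        using le mult_right_mono[OF d(3) norm_ge_zero[of x]] by simp
    qed
    then show "\<exists>\<Phi>. finite \<Phi> \<and> card \<Phi> \<le> card F \<and> (\<forall>x\<in>annihilated \<Phi>. norm (blinfun_apply (An n) x) \<le> \<epsilon> * norm x)"
      using F(1) by (intro exI[of _ ?\<Phi>]) (auto simp: card_image_le)
  qed
qed

lemma perturbation_bounded_below: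
  fixes A :: "'a::banach \<Rightarrow>\<^sub>L 'b::banach"
  assumes adj: "operator_adjustment N An (\<lambda>n. 0) = 0" and A: "lower_semi_Fredholm A"
  shows "\<exists>n0 L c. 0 < c \<and> (\<forall>n\<in>N. n0 \<le> n \<longrightarrow>
    (\<exists>E U. subspace E \<and> closed E \<and> quotient_basis E U \<and> card U \<le> L \<and>
      (\<forall>t x. 0 \<le> t \<longrightarrow> t \<le> 1 \<longrightarrow> x \<in> E \<longrightarrow> c * norm x \<le> norm (blinfun_apply (A + t *\<^sub>R An n) x))))"
proof -
  obtain \<Phi> c where \<Phi>: "finite \<Phi>" "0 < c" "\<And>x. x \<in> annihilated \<Phi> \<Longrightarrow> c * norm x \<le> norm (blinfun_apply A x)"
    using lower_semi_Fredholm_bounded_below[OF A] by blast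
  have c2: "0 < c / 2"
    using \<Phi>(2) by simp
  obtain m n0 where m: "\<forall>n\<in>N. n0 \<le> n \<longrightarrow>
    (\<exists>\<Psi>. finite \<Psi> \<and> card \<Psi> \<le> m \<and> (\<forall>x\<in>annihilated \<Psi>. norm (blinfun_apply (An n) x) \<le> c / 2 * norm x))"
    using operator_adjustment_zero_small[OF adj c2] by blast
  show ?thesis
  proof (rule exI[of _ n0], rule exI[of _ "card \<Phi> + m"], rule exI[of _ "c / 2"], intro conjI ballI impI)
    show "0 < c / 2" by fact
    fix n assume "n \<in> N" "n0 \<le> n"
    then obtain \<Psi> where \<Psi>: "finite \<Psi>" "card \<Psi> \<le> m"
      "\<And>x. x \<in> annihilated \<Psi> \<Longrightarrow> norm (blinfun_apply (An n) x) \<le> c / 2 * norm x"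
      using m by blast
    \<comment> \<open>\<open>E\<close> depends on n through \<Psi>, but
      \<open>card \<Phi> + m\<close> and c / 2 do not: on \<open>E\<close> the perturbation uses up
      at most half of the lower bound c of A.\<close>
    define E where "E = annihilated (\<Phi> \<union> \<Psi>)"
    obtain U where U: "quotient_basis E U" "card U \<le> card (\<Phi> \<union> \<Psi>)"
      using annihilated_quotient_basis[of "\<Phi> \<union> \<Psi>"] \<Phi>(1) \<Psi>(1) unfolding E_def by blast
    have "card U \<le> card \<Phi> + m"
      using U(2) card_Un_le[of \<Phi> \<Psi>] \<Psi>(2) by simp
    moreover have "c / 2 * norm x \<le> norm (blinfun_apply (A + t *\<^sub>R An n) x)"
      if t: "0 \<le> t" "t \<le> 1" and x: "x \<in> E" for t x
    proof -
      have x': "x \<in> annihilated \<Phi>" "x \<in> annihilated \<Psi>"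
        using x by (auto simp: E_def annihilated_Un)
      have "norm (t *\<^sub>R blinfun_apply (An n) x) \<le> c / 2 * norm x"
        using t \<Psi>(3)[OF x'(2)] mult_left_le_one_le[of "norm (blinfun_apply (An n) x)" t] by simp
      then show ?thesis
        using \<Phi>(3)[OF x'(1)] norm_diff_ineq[of "blinfun_apply A x" "t *\<^sub>R blinfun_apply (An n) x"]
        by (simp add: blinfun.add_left blinfun.scaleR_left)
    qed
    ultimately show "\<exists>E U. subspace E \<and> closed E \<and> quotient_basis E U \<and> card U \<le> card \<Phi> + m \<and>
      (\<forall>t x. 0 \<le> t \<longrightarrow> t \<le> 1 \<longrightarrow> x \<in> E \<longrightarrow> c / 2 * norm x \<le> norm (blinfun_apply (A + t *\<^sub>R An n) x))"
      using U(1) subspace_annihilated closed_annihilated unfolding E_def by blast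
  qed
qed

section \<open>Fredholm properties from a lower bound on a subspace of finite codimension\<close>

lemma lower_semi_Fredholm_if_bounded_below:
  fixes T :: "'a::banach \<Rightarrow>\<^sub>L 'b::banach"
  assumes E: "subspace E" "closed E" and U: "quotient_basis E U" and c: "0 < c"
    and below: "\<And>x. x \<in> E \<Longrightarrow> c * norm x \<le> norm (blinfun_apply T x)"
  shows "lower_semi_Fredholm T" "nullity T \<le> enat (card U)"
proof -
  have inj: "x = 0" if "x \<in> E" "blinfun_apply T x = 0" for x
    using below[OF that(1)] that(2) c by (simp add: mult_le_0_iff)
  obtain K where K: "span K = {x. blinfun_apply T x = 0}" "independent K" "mod_indep E K" "card K \<le> card U"
    using kernel_finite_basis[OF linear_blinfun_apply E(1) inj] U by (auto simp: quotient_basis_iff)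
  have "nullity T = enat (card K)"
    unfolding nullity_def K(1)[symmetric] using K(2,3) by (intro edim_span) (auto simp: mod_indep_def)
  then show null: "nullity T \<le> enat (card U)"
    using K(4) by simp
  \<comment> \<open>The range is the closed image of \<open>E\<close> enlarged by the span of
    finitely many vectors, hence closed.\<close>
  have U': "finite U" "span (E \<union> U) = UNIV"
    using U mod_span_iff_span[OF E(1)] by (auto simp: quotient_basis_iff)
  have "range (blinfun_apply T) = span (blinfun_apply T ` E \<union> blinfun_apply T ` U)"
    using linear_span_image[OF linear_blinfun_apply, of T "E \<union> U"] U'(2) by (simp add: image_Un)
  moreover have "closed \<dots>"
    using closed_image_bounded_below[OF E c below] subspace_blinfun_image[OF E(1)] U'(1)
    by (intro closed_span_Un_finite) auto
  ultimately show "lower_semi_Fredholm T"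
    using null le_less_trans[OF null, of \<infinity>] by (simp add: lower_semi_Fredholm_def)
qed

text \<open>The index is \<open>card U - card V\<close>, written additively to avoid truncated
  subtraction. For operators sharing \<open>E\<close>, equal codimensions of the images then mean
  equal indices.\<close>

lemma Fredholm_index_eq:
  fixes T :: "'a::banach \<Rightarrow>\<^sub>L 'b::banach"
  assumes T: "lower_semi_Fredholm T" and E: "subspace E"
    and inj: "\<And>x. x \<in> E \<Longrightarrow> blinfun_apply T x = 0 \<Longrightarrow> x = 0"
    and U: "quotient_basis E U" and V: "quotient_basis (blinfun_apply T ` E) V"
  obtains a b where "Fredholm T" "nullity T = enat a" "deficiency T = enat b" "a + card V = b + card U"
proof -
  obtain K D where KD: "finite K" "independent K" "span K = {x. blinfun_apply T x = 0}"
    "quotient_basis (range (blinfun_apply T)) D" "card K + card V = card D + card U"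
    using index_formula[OF linear_blinfun_apply E inj U V] by blast
  have "nullity T = enat (card K)"
    unfolding nullity_def KD(3)[symmetric] by (rule edim_span[OF KD(1,2)])
  moreover have "deficiency T = enat (card D)"
    unfolding deficiency_def using KD(4) by (intro quotient_edim_eq subspace_blinfun_image subspace_UNIV)
  moreover from this have "Fredholm T"
    using T by (simp add: Fredholm_def lower_semi_Fredholm_def)
  ultimately show thesis
    using that KD(5) by blast
qed

lemma Fredholm_perturbation:
  fixes A S :: "'a::banach \<Rightarrow>\<^sub>L 'b::banach"
  assumes A: "Fredholm A" and E: "subspace E" "closed E" and U: "quotient_basis E U" and c: "0 < c"
    and below: "\<And>t x. 0 \<le> t \<Longrightarrow> t \<le> 1 \<Longrightarrow> x \<in> E \<Longrightarrow> c * norm x \<le> norm (blinfun_apply (A + t *\<^sub>R S) x)"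
  shows "Fredholm (A + S)" "ind (A + S) = ind A" "deficiency (A + S) \<le> enat (card U) + deficiency A"
proof -
  have below0: "c * norm x \<le> norm (blinfun_apply A x)" and below1: "c * norm x \<le> norm (blinfun_apply (A + S) x)"
    if "x \<in> E" for x
    using below[of 0 x] below[of 1 x] that by auto
  have inj: "x = 0" if "x \<in> E" "blinfun_apply T x = 0" "c * norm x \<le> norm (blinfun_apply T x)" for x and T :: "'a \<Rightarrow>\<^sub>L 'b"
    using that c by (simp add: mult_le_0_iff)
  obtain D where D: "quotient_basis (range (blinfun_apply A)) D"
    using A quotient_edim_finite unfolding Fredholm_def deficiency_def by blast
  obtain V0 where "mod_span (blinfun_apply A ` E) V0"
    using range_mod_span[OF linear_blinfun_apply] U D unfolding quotient_basis_iff by blast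
  then obtain V where V: "quotient_basis (blinfun_apply A ` E) V"
    using mod_indep_extend[OF subspace_blinfun_image[OF E(1)] mod_indep_empty] by blast
  obtain V' where V': "quotient_basis (blinfun_apply (A + S) ` E) V'" "card V' = card V"
    using quotient_basis_homotopy[OF E c below V] by blast
  note lsF = lower_semi_Fredholm_if_bounded_below[OF E U c]
  obtain a b where a: "nullity A = enat a" "deficiency A = enat b" "a + card V = b + card U"
    using Fredholm_index_eq[OF lsF(1)[OF below0] E(1) inj[OF _ _ below0] U V] by blast
  obtain a' b' where a': "Fredholm (A + S)" "nullity (A + S) = enat a'" "deficiency (A + S) = enat b'"
      "a' + card V' = b' + card U"
    using Fredholm_index_eq[OF lsF(1)[OF below1] E(1) inj[OF _ _ below1] U V'(1)] by blast
  have sum: "a' + b = a + b'"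
    using a(3) a'(4) V'(2) by simp
  then have "real a' - real b' = real a - real b"
    by linarith
  then show "ind (A + S) = ind A"
    by (simp add: ind_def a a')
  show "Fredholm (A + S)" by fact
  \<comment> \<open>Equality of the indices gives b' = a' + b - a, so a bound for the nullity a'
    bounds the deficiency b'.\<close>
  have "a' \<le> card U"
    using lsF(2)[OF below1] a'(2) by simp
  then show "deficiency (A + S) \<le> enat (card U) + deficiency A"
    using sum by (simp add: a a')
qed

theorem theorem2p6p2:
  fixes A :: "'a::banach \<Rightarrow>\<^sub>L 'b::banach"
    and An :: "nat \<Rightarrow> 'a \<Rightarrow>\<^sub>L 'b"
    and N :: "nat set"
  assumes "infinite N"
    and "operator_adjustment N An (\<lambda>n. 0) = 0"
  shows "(lower_semi_Fredholm A \<longrightarrow>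
            (\<exists>n0 L :: nat. \<forall>n\<in>N. n0 \<le> n \<longrightarrow>
               lower_semi_Fredholm (A + An n) \<and> nullity (A + An n) \<le> enat L)) \<and>
         (Fredholm A \<longrightarrow>
            (\<exists>n0 S :: nat. \<forall>n\<in>N. n0 \<le> n \<longrightarrow>
               Fredholm (A + An n) \<and> ind (A + An n) = ind A \<and> deficiency (A + An n) \<le> enat S))"
proof (intro conjI impI)
  assume "lower_semi_Fredholm A"
  then obtain n0 L c where c: "0 < c" and E: "\<forall>n\<in>N. n0 \<le> n \<longrightarrow>
    (\<exists>E U. subspace E \<and> closed E \<and> quotient_basis E U \<and> card U \<le> L \<and>
      (\<forall>t x. 0 \<le> t \<longrightarrow> t \<le> 1 \<longrightarrow> x \<in> E \<longrightarrow> c * norm x \<le> norm (blinfun_apply (A + t *\<^sub>R An n) x)))"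
    using perturbation_bounded_below[OF assms(2)] by metis
  have "lower_semi_Fredholm (A + An n) \<and> nullity (A + An n) \<le> enat L" if n: "n \<in> N" "n0 \<le> n" for n
  proof -
    obtain E U where EU: "subspace E" "closed E" "quotient_basis E U" "card U \<le> L"
      and below: "\<And>t x. 0 \<le> t \<Longrightarrow> t \<le> 1 \<Longrightarrow> x \<in> E \<Longrightarrow> c * norm x \<le> norm (blinfun_apply (A + t *\<^sub>R An n) x)"
      using E n by blast
    have "c * norm x \<le> norm (blinfun_apply (A + An n) x)" if "x \<in> E" for x
      using below[of 1 x] that by simp
    note * = lower_semi_Fredholm_if_bounded_below[OF EU(1-3) c this]
    show ?thesis
      using * EU(4) by (meson enat_ord_simps(1) order_trans)
  qed
  then show "\<exists>n0 L :: nat. \<forall>n\<in>N. n0 \<le> n \<longrightarrow> lower_semi_Fredholm (A + An n) \<and> nullity (A + An n) \<le> enat L"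
    by blast
next
  assume A: "Fredholm A"
  then have "lower_semi_Fredholm A"
    by (simp add: Fredholm_def lower_semi_Fredholm_def)
  then obtain n0 L c where c: "0 < c" and E: "\<forall>n\<in>N. n0 \<le> n \<longrightarrow>
    (\<exists>E U. subspace E \<and> closed E \<and> quotient_basis E U \<and> card U \<le> L \<and>
      (\<forall>t x. 0 \<le> t \<longrightarrow> t \<le> 1 \<longrightarrow> x \<in> E \<longrightarrow> c * norm x \<le> norm (blinfun_apply (A + t *\<^sub>R An n) x)))"
    using perturbation_bounded_below[OF assms(2)] by metis
  obtain b where b: "deficiency A = enat b"
    using A by (auto simp: Fredholm_def)
  have "Fredholm (A + An n) \<and> ind (A + An n) = ind A \<and> deficiency (A + An n) \<le> enat (L + b)"
    if n: "n \<in> N" "n0 \<le> n" for n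
  proof -
    obtain E U where EU: "subspace E" "closed E" "quotient_basis E U" "card U \<le> L"
      and below: "\<And>t x. 0 \<le> t \<Longrightarrow> t \<le> 1 \<Longrightarrow> x \<in> E \<Longrightarrow> c * norm x \<le> norm (blinfun_apply (A + t *\<^sub>R An n) x)"
      using E n by blast
    note * = Fredholm_perturbation[OF A EU(1-3) c below]
    \<comment> \<open>\<open>card U\<close> is at most L for every such n, which makes S = L + b
      independent of n.\<close>
    have "enat (card U) + deficiency A \<le> enat (L + b)"
      using EU(4) b by simp
    then show ?thesis
      using * by (meson order_trans)
  qed
  then show "\<exists>n0 S :: nat. \<forall>n\<in>N. n0 \<le> n \<longrightarrow>
      Fredholm (A + An n) \<and> ind (A + An n) = ind A \<and> deficiency (A + An n) \<le> enat S"
    by blast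
qed

end
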